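(* The geometric thickness of the complete graph $K_{15}$ is $\overline{\theta}(K_{15}) = 4$.
   Context: The geometric thickness $\overline{\theta}(G)$ of a graph $G$ is the smallest integer $k$ such that there is an injective placement of the vertices of $G$ at points of the plane, with each edge drawn as the straight line segment between the points of its endpoints and containing no other vertex point, together with an assignment of each edge to one of $k$ layers, such that no two edges assigned to the same layer cross (i.e., two edges in the same layer meet at most in a common endpoint). *)

theory Defs
  imports "HOL-Analysis.Analysis"
begin

text \<open>A graph is given by a vertex set V and a set E of edges, each edge a 2-element
subset of V. A geometric drawing places vertices injectively in the plane (real \<times> real);
edge e is drawn as the straight segment convex hull (p ` e) between its endpoints.\<close>

definition edge_seg :: "('a \<Rightarrow> real \<times> real) \<Rightarrow> 'a set \<Rightarrow> (real \<times> real) set" where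
  "edge_seg p e = convex hull (p ` e)"

definition geom_layered :: "'a set \<Rightarrow> 'a set set \<Rightarrow> nat \<Rightarrow> bool" where
  "geom_layered V E k \<longleftrightarrow>
     (\<exists>(p :: 'a \<Rightarrow> real \<times> real) (layer :: 'a set \<Rightarrow> nat).
        inj_on p V \<and>
        (\<forall>e\<in>E. \<forall>w\<in>V. w \<notin> e \<longrightarrow> p w \<notin> edge_seg p e) \<and>
        (\<forall>e\<in>E. layer e < k) \<and>
        (\<forall>e1\<in>E. \<forall>e2\<in>E. e1 \<noteq> e2 \<and> layer e1 = layer e2 \<longrightarrow>
            edge_seg p e1 \<inter> edge_seg p e2 \<subseteq> p ` (e1 \<inter> e2)))"

definition geometric_thickness :: "'a set \<Rightarrow> 'a set set \<Rightarrow> nat" where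
  "geometric_thickness V E = (LEAST k. geom_layered V E k)"

definition complete_vertices :: "nat \<Rightarrow> nat set" where
  "complete_vertices n = {0..<n}"

definition complete_edges :: "nat \<Rightarrow> nat set set" where
  "complete_edges n = {{u, v} | u v. u < n \<and> v < n \<and> u \<noteq> v}"

end

theory Submission
  imports Defs
begin

text \<open>
  No three points of a drawing of a complete graph are collinear, so all crossings are determined
  by orientations of triples. A plane straight-line drawing with n vertices and h hull edges has at
  most 3n - 3 - h edges. Suppose that three plane layers cover all 105 edges. An edge that nothing
  crosses may be put into all three layers, so with u such edges the layers have at least 105 + 2u
  edges in total, against an upper bound of 126 - 3h. Hull edges are uncrossed, which settles h of
  at least 5. At a corner of the hull, the inner vertex farthest from the chord between the two
  neighbours of the corner can be joined to it without crossings; this adds an uncrossed edge when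
  h = 4, and three of them when h = 3. In the latter case one more edge is needed. Let a be a corner,
  a' its farthest inner vertex, and q the second farthest one. Each layer can take aq or a'q, because
  aq is crossed only by edges at a', and a'q only by edges at a, and two such edges cross each other.
\<close>

subsection \<open>Orientations and crossing segments\<close>

text \<open>Twice the signed area of the triangle, positive for counterclockwise order. The type is
  any ordered integral domain, so that the same function can be evaluated on integer coordinates in
  the final finite check.\<close>

definition orient :: "'a \<times> 'a \<Rightarrow> 'a \<times> 'a \<Rightarrow> 'a \<times> 'a \<Rightarrow> 'a::linordered_idom" where
  "orient a b c = (fst b - fst a) * (snd c - snd a) - (snd b - snd a) * (fst c - fst a)"

text \<open>Strict signs on both sides: only crossings in the interiors of both segments count, so
  segments with a common endpoint never cross in this sense.\<close>

definition crosses :: "'a \<times> 'a \<Rightarrow> 'a \<times> 'a \<Rightarrow> 'a \<times> 'a \<Rightarrow> 'a::linordered_idom \<times> 'a \<Rightarrow> bool" where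
  "crosses a b c d \<longleftrightarrow> orient a b c * orient a b d < 0 \<and> orient c d a * orient c d b < 0"

lemma orient_rotate: "orient b c a = orient a b c"
  by (simp add: orient_def algebra_simps)

lemma orient_swap: "orient b a c = - orient a b c"
  by (simp add: orient_def algebra_simps)

lemma orient_degenerate [simp]: "orient a a b = 0" "orient a b a = 0" "orient a b b = 0"
  by (simp_all add: orient_def)

lemma crosses_commute: "crosses a b c d \<longleftrightarrow> crosses c d a b"
  by (auto simp: crosses_def)

lemma crosses_flip: "crosses b a c d \<longleftrightarrow> crosses a b c d"
  unfolding crosses_def by (simp add: orient_swap[of b a] mult.commute)

lemma crosses_flip_right: "crosses a b d c \<longleftrightarrow> crosses a b c d"
  using crosses_flip crosses_commute by metis

lemma orient_affine:
  fixes a b c d :: "real \<times> real"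
  shows "orient a b ((1 - t) *\<^sub>R c + t *\<^sub>R d) = (1 - t) * orient a b c + t * orient a b d"
  by (simp add: orient_def algebra_simps)

lemma crosses_imp_meet:
  fixes a b c d :: "real \<times> real"
  assumes "crosses a b c d"
  shows "closed_segment a b \<inter> closed_segment c d \<noteq> {}"
proof -
  have between: "0 \<le> u / (u - v) \<and> u / (u - v) \<le> 1 \<and> u - v \<noteq> 0" if "u * v < 0" for u v :: real
    using that by (auto simp: divide_simps mult_less_0_iff)
  define s where "s = orient c d a / (orient c d a - orient c d b)"
  define t where "t = orient a b c / (orient a b c - orient a b d)"
  have D: "orient c d a - orient c d b \<noteq> 0" "orient a b c - orient a b d \<noteq> 0"
    and st: "0 \<le> s" "s \<le> 1" "0 \<le> t" "t \<le> 1"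
    using assms between unfolding s_def t_def crosses_def by blast+
  \<comment> \<open>Both denominators are, up to sign, the cross product of the two directions, so
    the two parameters have a common denominator.\<close>
  have opp: "orient a b c - orient a b d = - (orient c d a - orient c d b)"
    by (simp add: orient_def algebra_simps)
  have "(1 - s) * fst a + s * fst b = (1 - t) * fst c + t * fst d"
    "(1 - s) * snd a + s * snd b = (1 - t) * snd c + t * snd d"
    using D unfolding s_def t_def opp
    by (simp_all add: divide_simps) (simp_all add: orient_def algebra_simps)
  then have "(1 - s) *\<^sub>R a + s *\<^sub>R b = (1 - t) *\<^sub>R c + t *\<^sub>R d"
    by (simp add: prod_eq_iff)
  then show ?thesis using st by (auto simp: closed_segment_def)
qed

text \<open>At the common point the affine function \<open>orient a b\<close> vanishes. It is
  nonzero at \<open>c\<close> and \<open>d\<close>, so its signs there are opposite; the same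
  argument applies with the segments exchanged.\<close>

lemma meet_imp_crosses:
  fixes a b c d :: "real \<times> real"
  assumes "orient a b c \<noteq> 0" "orient a b d \<noteq> 0" "orient c d a \<noteq> 0" "orient c d b \<noteq> 0"
    and "closed_segment a b \<inter> closed_segment c d \<noteq> {}"
  shows "crosses a b c d"
proof -
  have opp: "u * v < 0" if "(1 - t) * u + t * v = 0" "0 \<le> t" "t \<le> 1" "u \<noteq> 0" "v \<noteq> 0" for t u v :: real
  proof -
    have "t \<noteq> 0" "t \<noteq> 1" using that by auto
    then have t: "0 < t" "0 < 1 - t" using that by auto
    have "t * (u * v) = - ((1 - t) * (u * u))" using that(1) by algebra
    also have "\<dots> < 0" using t that(4) by (auto simp: zero_less_mult_iff)
    finally show ?thesis using t by (simp add: mult_less_0_iff)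
  qed
  obtain s t where st: "0 \<le> s" "s \<le> 1" "0 \<le> t" "t \<le> 1"
    and eq: "(1 - s) *\<^sub>R a + s *\<^sub>R b = (1 - t) *\<^sub>R c + t *\<^sub>R d"
    using assms(5) by (metis disjoint_iff in_segment(1))
  have "(1 - t) * orient a b c + t * orient a b d = 0"
    using orient_affine[of a b s a b] orient_affine[of a b t c d] eq by simp
  moreover have "(1 - s) * orient c d a + s * orient c d b = 0"
    using orient_affine[of c d s a b] orient_affine[of c d t c d] eq by simp
  ultimately show ?thesis unfolding crosses_def using opp st assms(1-4) by blast
qed

lemma meet_at_endpoint:
  fixes a b c :: "real \<times> real"
  assumes "orient a b c \<noteq> 0"
  shows "closed_segment a b \<inter> closed_segment a c \<subseteq> {a}"
proof
  fix x assume "x \<in> closed_segment a b \<inter> closed_segment a c"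
  then obtain s t where x: "x = (1 - s) *\<^sub>R a + s *\<^sub>R b" "x = (1 - t) *\<^sub>R a + t *\<^sub>R c"
    unfolding Int_iff in_segment by blast
  then have "t * orient a b c = 0"
    using orient_affine[of a b s a b] orient_affine[of a b t a c] by simp
  then show "x \<in> {a}" using assms x by simp
qed

lemma orient_0_imp_between:
  fixes a b c :: "real \<times> real"
  assumes "orient a b c = 0"
  shows "a \<in> closed_segment b c \<or> b \<in> closed_segment a c \<or> c \<in> closed_segment a b"
proof -
  have "collinear {a, b, c}"
  proof (cases "a = b")
    case False
    define v where "v = (if fst b = fst a then (snd c - snd a) / (snd b - snd a)
      else (fst c - fst a) / (fst b - fst a))"
    have "fst b \<noteq> fst a \<or> snd b \<noteq> snd a" using False by (auto simp: prod_eq_iff)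
    then have "c - a = v *\<^sub>R (b - a)" using assms
      unfolding v_def orient_def by (auto simp: prod_eq_iff field_simps)
    then have "c = (1 - v) *\<^sub>R a + v *\<^sub>R b" by (simp add: algebra_simps)
    then have "collinear {a, c, b}"
      by (smt (verit) collinear_3_expand)
    then show ?thesis by (simp add: insert_commute)
  qed simp
  then show ?thesis
    unfolding collinear_between_cases between_mem_segment by (auto simp: closed_segment_commute)
qed

subsection \<open>Edge bound for plane drawings\<close>

definition general_position :: "('v \<Rightarrow> real \<times> real) \<Rightarrow> 'v set \<Rightarrow> bool" where
  "general_position p V \<longleftrightarrow>
     (\<forall>a\<in>V. \<forall>b\<in>V. \<forall>c\<in>V. a \<noteq> b \<longrightarrow> a \<noteq> c \<longrightarrow> b \<noteq> c \<longrightarrow> orient (p a) (p b) (p c) \<noteq> 0)"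

lemma general_positionD:
  assumes "general_position p V" "a \<in> V" "b \<in> V" "c \<in> V" "a \<noteq> b" "a \<noteq> c" "b \<noteq> c"
  shows "orient (p a) (p b) (p c) \<noteq> 0"
  using assms by (simp add: general_position_def)

section \<open>Segments as affine functions of the abscissa\<close>

definition slope :: "real \<times> real \<Rightarrow> real \<times> real \<Rightarrow> real" where
  "slope a b = (snd b - snd a) / (fst b - fst a)"

definition height :: "real \<times> real \<Rightarrow> real \<times> real \<Rightarrow> real \<Rightarrow> real" where
  "height a b t = snd a + slope a b * (t - fst a)"

lemma height_eq: "fst a \<noteq> fst b \<Longrightarrow> height a b t = height a b u + slope a b * (t - u)"
  by (simp add: height_def algebra_simps)

lemma height_ends [simp]: "height a b (fst a) = snd a" "fst a \<noteq> fst b \<Longrightarrow> height a b (fst b) = snd b"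
  by (simp_all add: height_def slope_def)

lemma orient_height:
  assumes "fst a \<noteq> fst b"
  shows "orient a b c = (fst b - fst a) * (snd c - height a b (fst c))"
  using assms by (simp add: height_def slope_def orient_def field_simps)

lemma orient_height_iff:
  assumes "fst a < fst b"
  shows "orient a b c < 0 \<longleftrightarrow> snd c < height a b (fst c)"
    and "orient a b c > 0 \<longleftrightarrow> snd c > height a b (fst c)"
    and "orient a b c = 0 \<longleftrightarrow> snd c = height a b (fst c)"
  using assms by (auto simp: orient_height mult_less_0_iff zero_less_mult_iff)

text \<open>The difference of the two heights is affine. Its sign at \<open>u\<close> persists to
  the left of \<open>u\<close>, where both left ends lie, and its sign at \<open>v\<close> persists
  to the right of \<open>v\<close>, where both right ends lie; these are the signs of a
  crossing.\<close>

lemma height_cross: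
  assumes ab: "fst a < fst b" and cd: "fst c < fst d"
    and u: "fst a \<le> u" "fst c \<le> u" "u < v" "v \<le> fst b" "v \<le> fst d"
    and lt: "height a b u < height c d u" "height c d v < height a b v"
  shows "crosses a b c d"
proof -
  have aff: "height c d t - height a b t = height c d u - height a b u + (slope c d - slope a b) * (t - u)" for t
    using height_eq[of a b t u] height_eq[of c d t u] ab cd by (simp add: algebra_simps)
  have "(slope c d - slope a b) * (v - u) < 0" using aff[of v] lt by simp
  then have k: "slope c d - slope a b < 0" using u by (simp add: mult_less_0_iff)
  have left: "height c d t - height a b t > 0" if "t \<le> u" for t
    using aff[of t] lt(1) mult_nonpos_nonpos[of "slope c d - slope a b" "t - u"] k that by linarith
  have aff': "height c d t - height a b t = height c d v - height a b v + (slope c d - slope a b) * (t - v)" for t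
    using height_eq[of a b t v] height_eq[of c d t v] ab cd by (simp add: algebra_simps)
  have right: "height c d t - height a b t < 0" if "v \<le> t" for t
    using aff'[of t] lt(2) mult_nonpos_nonneg[of "slope c d - slope a b" "t - v"] k that by linarith
  have "orient c d a < 0" "orient c d b > 0" "orient a b c > 0" "orient a b d < 0"
    using left[of "fst a"] left[of "fst c"] right[of "fst b"] right[of "fst d"] ab cd u
    by (simp_all add: orient_height_iff)
  then show ?thesis by (simp add: crosses_def mult_less_0_iff)
qed

text \<open>The height difference is a multiple of \<open>t - u\<close>. Unless the slopes agree it
  changes sign at \<open>u\<close>, which lies strictly inside both abscissa ranges.\<close>

lemma height_meet:
  assumes ab: "fst a < u" "u < fst b" and cd: "fst c < u" "u < fst d"
    and eq: "height a b u = height c d u"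
  shows "crosses a b c d \<or> slope a b = slope c d"
proof (rule disjCI)
  assume ne: "slope a b \<noteq> slope c d"
  have aff: "height c d t - height a b t = (slope c d - slope a b) * (t - u)" for t
    using height_eq[of a b t u] height_eq[of c d t u] ab cd eq by (simp add: algebra_simps)
  have "snd c - height a b (fst c) = (slope c d - slope a b) * (fst c - u)"
    "snd d - height a b (fst d) = (slope c d - slope a b) * (fst d - u)"
    "snd a - height c d (fst a) = - ((slope c d - slope a b) * (fst a - u))"
    "snd b - height c d (fst b) = - ((slope c d - slope a b) * (fst b - u))"
    using aff[of "fst c"] aff[of "fst d"] aff[of "fst a"] aff[of "fst b"] ab cd by simp_all
  then show "crosses a b c d"
    using ne ab cd unfolding crosses_def
    by (simp add: orient_height mult_less_0_iff zero_less_mult_iff) (smt (verit))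
qed

text \<open>Used with a hull edge from \<open>a\<close> to \<open>b\<close>. Equality is allowed at
  \<open>c\<close> because an edge of the drawing may start at the left end of the hull edge;
  affinity makes the comparison strict inside.\<close>

lemma height_less:
  assumes cd: "fst c < t" "t < fst d" and ab: "fst a < fst b"
  shows "snd c \<le> height a b (fst c) \<Longrightarrow> snd d < height a b (fst d) \<Longrightarrow> height c d t < height a b t"
    and "snd c \<ge> height a b (fst c) \<Longrightarrow> snd d > height a b (fst d) \<Longrightarrow> height c d t > height a b t"
proof -
  define k where "k = slope c d - slope a b"
  have C: "snd c - height a b (fst c) = height c d t - height a b t + k * (fst c - t)"
    and D: "snd d - height a b (fst d) = height c d t - height a b t + k * (fst d - t)"
    using height_eq[of a b "fst c" t] height_eq[of c d "fst c" t]
      height_eq[of a b "fst d" t] height_eq[of c d "fst d" t] cd ab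
    by (simp_all add: k_def algebra_simps)
  have sgn: "k * (fst c - t) \<ge> 0 \<and> k * (fst d - t) \<le> 0 \<or> k * (fst c - t) \<le> 0 \<and> k * (fst d - t) \<ge> 0"
    using cd by (cases "k \<ge> 0") (auto simp: mult_le_0_iff zero_le_mult_iff)
  have eq: "k * (fst d - t) = 0 \<longleftrightarrow> k * (fst c - t) = 0" using cd by auto
  show "height c d t < height a b t" if "snd c \<le> height a b (fst c)" "snd d < height a b (fst d)"
    using that C D sgn eq by linarith
  show "height c d t > height a b t" if "snd c \<ge> height a b (fst c)" "snd d > height a b (fst d)"
    using that C D sgn eq by linarith
qed

text \<open>Lines through a common right end fan out to its left, where a larger slope means a lower
  position. Slopes thus order the left edges of a vertex.\<close>

lemma slope_height:
  assumes "fst l < fst r" "t < fst r" "fst l' < fst r"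
  shows "slope l' r < slope l r \<longleftrightarrow> height l r t < height l' r t"
    and "slope l' r \<le> slope l r \<longleftrightarrow> height l r t \<le> height l' r t"
proof -
  have "height l r t = snd r - slope l r * (fst r - t)" "height l' r t = snd r - slope l' r * (fst r - t)"
    using height_eq[of l r t "fst r"] height_eq[of l' r t "fst r"] assms by (simp_all add: algebra_simps)
  then show "slope l' r < slope l r \<longleftrightarrow> height l r t < height l' r t"
    "slope l' r \<le> slope l r \<longleftrightarrow> height l r t \<le> height l' r t" using assms by simp_all
qed

text \<open>Pairwise distinct abscissas give every edge a left and a right end. The general case is
  reduced to this one by a shear.\<close>

locale left_right_drawing =
  fixes p :: "'v \<Rightarrow> real \<times> real" and V :: "'v set" and D :: "('v \<times> 'v) set"
  assumes fin: "finite V" and ne: "V \<noteq> {}"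
    and gp: "general_position p V"
    and inj_x: "inj_on (\<lambda>v. fst (p v)) V"
    and D_sub: "D \<subseteq> V \<times> V"
    and D_less: "(l, r) \<in> D \<Longrightarrow> fst (p l) < fst (p r)"
    and nocross: "(a, b) \<in> D \<Longrightarrow> (c, d) \<in> D \<Longrightarrow> \<not> crosses (p a) (p b) (p c) (p d)"
begin

abbreviation X where "X v \<equiv> fst (p v)"
abbreviation S where "S a b \<equiv> slope (p a) (p b)"
abbreviation H where "H a b \<equiv> height (p a) (p b)"

text \<open>Each edge (l, r) other than the topmost left edge of r charges the rightmost vertex u of the
  wedge between it and the next left edge of r above it. If u is not the left end of that next edge,
  the next edge is the first edge above u; otherwise (l, r) is the first edge below u. Hence every
  vertex is charged at most once from above and at most once from below, and never from the outer
  side of a hull edge.\<close>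

definition above where
  "above l r = {l'. (l', r) \<in> D \<and> S l' r < S l r}"

definition nxt where
  "nxt l r = arg_min_on (\<lambda>l'. - S l' r) (above l r)"

definition wedge where
  "wedge l r = {w \<in> V. X w < X r \<and> S (nxt l r) r \<le> S w r \<and> S w r \<le> S l r}"

definition apex where
  "apex l r = arg_min_on (\<lambda>w. - X w) (wedge l r)"

definition lower where
  "lower = {(l, r) \<in> D. above l r \<noteq> {}}"

text \<open>The Boolean names one of two slots at the apex: True for the slot above it, False for
  the slot below it.\<close>

definition charge where
  "charge = (\<lambda>(l, r). (apex l r, apex l r \<noteq> nxt l r))"

lemma D_V: "(a, b) \<in> D \<Longrightarrow> a \<in> V \<and> b \<in> V" using D_sub by auto

lemma finite_D: "finite D" using D_sub fin by (meson finite_SigmaI finite_subset)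

lemma S_inj:
  assumes "a \<in> V" "b \<in> V" "r \<in> V" "X a < X r" "X b < X r" "S a r = S b r"
  shows "a = b"
proof (rule ccontr)
  assume "a \<noteq> b"
  have "H a r (X b) = H b r (X b)"
    using slope_height(2)[of "p a" "p r" "X b" "p b"] slope_height(2)[of "p b" "p r" "X b" "p a"]
      assms(4-6) by linarith
  then have "orient (p a) (p r) (p b) = 0" using assms(4,5) by (simp add: orient_height_iff)
  moreover have "a \<noteq> r" "b \<noteq> r" using assms by auto
  ultimately show False using general_positionD[OF gp] \<open>a \<noteq> b\<close> assms(1-3) by metis
qed

lemma finite_above: "finite (above l r)"
  using D_sub by (intro finite_subset[OF _ fin]) (auto simp: above_def)

lemma nxt:
  assumes "(l, r) \<in> lower"
  shows "(nxt l r, r) \<in> D" "S (nxt l r) r < S l r"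
    and "\<And>m. (m, r) \<in> D \<Longrightarrow> S m r < S l r \<Longrightarrow> S m r \<le> S (nxt l r) r"
proof -
  have ne: "above l r \<noteq> {}" using assms by (auto simp: lower_def)
  have "nxt l r \<in> above l r" unfolding nxt_def
    using arg_min_if_finite(1)[OF finite_above ne] .
  then show "(nxt l r, r) \<in> D" "S (nxt l r) r < S l r" by (auto simp: above_def)
  show "S m r \<le> S (nxt l r) r" if "(m, r) \<in> D" "S m r < S l r" for m
    using arg_min_if_finite(2)[OF finite_above ne, of "\<lambda>l'. - S l' r"] that
    unfolding nxt_def above_def by (auto simp: not_less)
qed

lemma lower_D: "(l, r) \<in> lower \<Longrightarrow> (l, r) \<in> D"
  by (auto simp: lower_def)

lemma apex:
  assumes "(l, r) \<in> lower"
  shows "apex l r \<in> V" "X (apex l r) < X r" "S (nxt l r) r \<le> S (apex l r) r" "S (apex l r) r \<le> S l r"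
    and "X l \<le> X (apex l r)" "X (nxt l r) \<le> X (apex l r)"
    and "\<And>w. w \<in> wedge l r \<Longrightarrow> X w \<le> X (apex l r)"
proof -
  note n = nxt[OF assms] and d = lower_D[OF assms]
  have l: "l \<in> wedge l r" "nxt l r \<in> wedge l r"
    using n d D_V D_less by (auto simp: wedge_def)
  have f: "finite (wedge l r)" using fin by (simp add: wedge_def)
  have a: "apex l r \<in> wedge l r" unfolding apex_def
    using arg_min_if_finite(1)[OF f] l by blast
  then show "apex l r \<in> V" "X (apex l r) < X r" "S (nxt l r) r \<le> S (apex l r) r" "S (apex l r) r \<le> S l r"
    by (auto simp: wedge_def)
  show m: "X w \<le> X (apex l r)" if "w \<in> wedge l r" for w
    using arg_min_if_finite(2)[OF f, of "\<lambda>w. - X w"] that unfolding apex_def by (auto simp: not_less)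
  show "X l \<le> X (apex l r)" "X (nxt l r) \<le> X (apex l r)" using m l by auto
qed

text \<open>Right of the apex, an edge inside the gap has three ways to end. If it continues beyond
  \<open>r\<close>, it passes above or below \<open>r\<close> and crosses a side of the wedge. If it
  ends at \<open>r\<close>, it lies between two consecutive left edges of \<open>r\<close>. If it
  ends before \<open>r\<close>, its end lies outside the wedge, in which the apex is rightmost, so
  it again crosses a side.\<close>

lemma gap_clean:
  assumes e: "(l, r) \<in> lower" and f: "(a, b) \<in> D"
    and ab: "X a < X (apex l r)" "X (apex l r) < X b"
    and lo: "H l r (X (apex l r)) < H a b (X (apex l r))"
    and hi: "H a b (X (apex l r)) < H (nxt l r) r (X (apex l r))"
  shows False
proof -
  define u where "u = X (apex l r)"
  define l' where "l' = nxt l r"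
  note n = nxt[OF e, folded l'_def] and A = apex[OF e, folded l'_def u_def]
  note lo = lo[folded u_def] and hi = hi[folded u_def l'_def] and ab = ab[folded u_def]
  have lr: "(l, r) \<in> D" using e by (rule lower_D)
  have less: "X l < X r" "X l' < X r" "X a < X b" using D_less lr n f by auto
  have hi': False if "u < v" "v \<le> X r" "v \<le> X b" "H l' r v < H a b v" for v
    using height_cross[of "p a" "p b" "p l'" "p r" u v] that less ab A hi nocross[OF f n(1)] by simp
  have lo': False if "u < v" "v \<le> X r" "v \<le> X b" "H a b v < H l r v" for v
    using height_cross[of "p l" "p r" "p a" "p b" u v] that less ab A lo nocross[OF lr f] by simp
  consider "X r < X b" | "X b = X r" | "X b < X r" by linarith
  then show False
  proof cases
    case 1
    then have d: "a \<noteq> b" "a \<noteq> r" "b \<noteq> r" using less ab A(2) by auto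
    then have "orient (p a) (p b) (p r) \<noteq> 0"
      using general_positionD[OF gp] D_V[OF f] D_V[OF lr] by metis
    then have "H a b (X r) \<noteq> snd (p r)" using less by (simp add: orient_height_iff)
    then show False using hi'[of "X r"] lo'[of "X r"] 1 A(2) less by (auto simp: neq_iff)
  next
    case 2
    then have br: "b = r" using inj_x D_V[OF f] D_V[OF lr] by (auto dest: inj_onD)
    have "S l' r < S a r" "S a r < S l r"
      using slope_height(1)[of "p a" "p r" u "p l'"] slope_height(1)[of "p l" "p r" u "p a"] lo hi less A(2) br
      by auto
    then show False using n(3)[of a] f br by auto
  next
    case 3
    have sb: "S l' r \<le> S b r \<longleftrightarrow> snd (p b) \<le> H l' r (X b)" "S b r \<le> S l r \<longleftrightarrow> H l r (X b) \<le> snd (p b)"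
      using slope_height(2)[of "p b" "p r" "X b" "p l'"] slope_height(2)[of "p l" "p r" "X b" "p b"] less 3
      by auto
    have "b \<notin> wedge l r" using A(7)[of b] ab by auto
    then have "H l' r (X b) < snd (p b) \<or> snd (p b) < H l r (X b)"
      using 3 D_V[OF f] sb unfolding wedge_def l'_def[symmetric] by auto
    then show False using hi'[of "X b"] lo'[of "X b"] 3 ab less by auto
  qed
qed

text \<open>Two edges that meet at an inner abscissa without crossing lie on one line, and in
  general position a line carries only two vertices.\<close>

lemma same_height_eq:
  assumes f: "(a, b) \<in> D" "(c, d) \<in> D"
    and u: "X a < u" "u < X b" "X c < u" "u < X d" and eq: "H a b u = H c d u"
  shows "a = c \<and> b = d"
proof -
  have s: "S a b = S c d" using height_meet[of "p a" u "p b" "p c" "p d"] u eq nocross[OF f] by auto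
  have "H a b t = H c d t" for t
    using height_eq[of "p a" "p b" t u] height_eq[of "p c" "p d" t u] s eq u by simp
  then have o: "orient (p a) (p b) (p c) = 0" "orient (p a) (p b) (p d) = 0"
    using u by (simp_all add: orient_height_iff)
  have "a \<noteq> b" "a \<noteq> d" "b \<noteq> c" "c \<noteq> d" using u by auto
  then show ?thesis using o general_positionD[OF gp] D_V[OF f(1)] D_V[OF f(2)] by metis
qed

text \<open>The last inequality is weak because the apex may be \<open>l\<close> itself.\<close>

lemma apex_ne_nxt_below:
  assumes e: "(l, r) \<in> lower" and ne: "apex l r \<noteq> nxt l r"
  shows "X (nxt l r) < X (apex l r)" "snd (p (apex l r)) < H (nxt l r) r (X (apex l r))"
    "H l r (X (apex l r)) \<le> snd (p (apex l r))"
proof -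
  note n = nxt[OF e] and A = apex[OF e] and d = lower_D[OF e]
  have V: "nxt l r \<in> V" "r \<in> V" using D_V[OF n(1)] by auto
  have less: "X l < X r" "X (nxt l r) < X r" using D_less d n(1) by auto
  show "X (nxt l r) < X (apex l r)"
    using A(1,6) V ne inj_x by (metis inj_onD order_le_less)
  have "S (nxt l r) r \<noteq> S (apex l r) r" using S_inj[OF V(1) A(1) V(2) less(2) A(2)] ne by metis
  then have "S (nxt l r) r < S (apex l r) r" using A(3) by simp
  then show "snd (p (apex l r)) < H (nxt l r) r (X (apex l r))"
    using slope_height(1)[of "p (apex l r)" "p r" "X (apex l r)" "p (nxt l r)"] A(2) less by simp
  show "H l r (X (apex l r)) \<le> snd (p (apex l r))"
    using slope_height(2)[of "p l" "p r" "X (apex l r)" "p (apex l r)"] A(2,4) less by simp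
qed

lemma apex_eq_nxt_above:
  assumes e: "(l, r) \<in> lower" and eq: "apex l r = nxt l r"
  shows "X l < X (apex l r)" "H l r (X (apex l r)) < snd (p (apex l r))"
proof -
  note n = nxt[OF e] and A = apex[OF e] and d = lower_D[OF e]
  have less: "X l < X r" "X (nxt l r) < X r" using D_less d n(1) by auto
  have "l \<noteq> nxt l r" using n(2) by auto
  then show "X l < X (apex l r)" using A(1,5) D_V[OF d] eq inj_x by (metis inj_onD order_le_less)
  show "H l r (X (apex l r)) < snd (p (apex l r))"
    using slope_height(1)[of "p l" "p r" "X (apex l r)" "p (nxt l r)"] n(2) less eq by simp
qed

text \<open>By \<open>gap_clean\<close>, an edge that charges from below lies directly below its
  apex, and for a charge from above the next edge lies directly above the apex. Two charges to one
  slot therefore agree in that edge, as a comparison of heights at the apex shows.\<close>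

lemma inj_on_charge: "inj_on charge lower"
proof -
  have "l1 = l2 \<and> r1 = r2" if e: "(l1, r1) \<in> lower" "(l2, r2) \<in> lower"
    and u: "apex l1 r1 = apex l2 r2" and dir: "(apex l1 r1 \<noteq> nxt l1 r1) = (apex l2 r2 \<noteq> nxt l2 r2)"
  for l1 r1 l2 r2
  proof (cases "apex l1 r1 = nxt l1 r1")
    case True
    note a1 = apex_eq_nxt_above[OF e(1) True]
    have eq2: "apex l2 r2 = nxt l2 r2" using True dir by simp
    note a2 = apex_eq_nxt_above[OF e(2) eq2]
    note d = lower_D[OF e(1)] lower_D[OF e(2)]
    let ?u = "X (apex l1 r1)"
    have ur: "?u < X r1" "?u < X r2" using apex(2)[OF e(1)] apex(2)[OF e(2)] u by auto
    have "\<not> H l1 r1 ?u < H l2 r2 ?u"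
      using gap_clean[OF e(1) d(2)] a1 a2 ur u True by auto
    moreover have "\<not> H l2 r2 ?u < H l1 r1 ?u"
      using gap_clean[OF e(2) d(1)] a1 a2 ur u eq2 by auto
    ultimately show ?thesis using same_height_eq[OF d] a1 a2 ur u by auto
  next
    case False
    have ne2: "apex l2 r2 \<noteq> nxt l2 r2" using False dir by simp
    note a1 = apex_ne_nxt_below[OF e(1) False] and a2 = apex_ne_nxt_below[OF e(2) ne2]
    note n1 = nxt[OF e(1)] and n2 = nxt[OF e(2)]
    let ?u = "X (apex l1 r1)"
    have ur: "?u < X r1" "?u < X r2" using apex(2)[OF e(1)] apex(2)[OF e(2)] u by auto
    have "\<not> H (nxt l1 r1) r1 ?u < H (nxt l2 r2) r2 ?u"
      using gap_clean[OF e(2) n1(1)] a1 a2 ur u by auto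
    moreover have "\<not> H (nxt l2 r2) r2 ?u < H (nxt l1 r1) r1 ?u"
      using gap_clean[OF e(1) n2(1)] a1 a2 ur u by auto
    ultimately have same: "nxt l1 r1 = nxt l2 r2" "r1 = r2"
      using same_height_eq[OF n1(1) n2(1)] a1 a2 ur u by auto
    note d = lower_D[OF e(1)] lower_D[OF e(2)]
    \<comment> \<open>Both edges are the left edge of \<open>r1\<close> that follows the common next
      edge in slope order.\<close>
    have "S l1 r1 = S l2 r1"
      using n1(2) n2(2) n1(3)[of l2] n2(3)[of l1] d same by (metis not_le order_less_le linorder_neqE)
    then show ?thesis using S_inj[of l1 l2 r1] D_V d D_less same by metis
  qed
  then show ?thesis by (auto simp: inj_on_def charge_def)
qed

definition upper_hull where
  "upper_hull = {(a, b). a \<in> V \<and> b \<in> V \<and> X a < X b \<and> (\<forall>c\<in>V - {a, b}. orient (p a) (p b) (p c) < 0)}"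

definition lower_hull where
  "lower_hull = {(a, b). a \<in> V \<and> b \<in> V \<and> X a < X b \<and> (\<forall>c\<in>V - {a, b}. orient (p a) (p b) (p c) > 0)}"

lemma finite_hull: "finite upper_hull" "finite lower_hull"
  using fin by (auto simp: upper_hull_def lower_hull_def intro: finite_subset[of _ "V \<times> V"])

lemma inj_on_hull: "inj_on snd upper_hull" "inj_on snd lower_hull"
proof -
  have sw: "orient (p b) (p r) (p a) = - orient (p a) (p r) (p b)" for a b r
    by (simp add: orient_def algebra_simps)
  have "a = b" if "(a, r) \<in> upper_hull" "(b, r) \<in> upper_hull" for a b r
    using that sw[of b r a] unfolding upper_hull_def by (auto, force)
  then show "inj_on snd upper_hull" by (force intro: inj_onI)
  have "a = b" if "(a, r) \<in> lower_hull" "(b, r) \<in> lower_hull" for a b r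
    using that sw[of b r a] unfolding lower_hull_def by (auto, force)
  then show "inj_on snd lower_hull" by (force intro: inj_onI)
qed

text \<open>If \<open>b\<close> were charged from above, the next edge would pass strictly above
  \<open>b\<close>, although both its ends lie on or below the line of the upper hull edge ending at
  \<open>b\<close>; the lower hull is symmetric. The last claim keeps the leftmost vertex free of
  charges.\<close>

lemma charge_not_hull:
  assumes e: "(l, r) \<in> lower"
  shows "(a, b) \<in> upper_hull \<Longrightarrow> charge (l, r) \<noteq> (b, True)"
    and "(a, b) \<in> lower_hull \<Longrightarrow> charge (l, r) \<noteq> (b, False)"
    and "\<exists>v\<in>V. X v < X (apex l r)"
proof -
  note n = nxt[OF e] and d = lower_D[OF e]
  show "charge (l, r) \<noteq> (b, True)" if h: "(a, b) \<in> upper_hull"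
  proof
    assume "charge (l, r) = (b, True)"
    then have b: "apex l r = b" "apex l r \<noteq> nxt l r" by (auto simp: charge_def)
    note A = apex_ne_nxt_below[OF e b(2), unfolded b(1)]
    have less: "X (nxt l r) < X b" "X b < X r" using A apex(2)[OF e] b by auto
    have hab: "X a < X b" "\<And>c. c \<in> V \<Longrightarrow> c \<noteq> a \<Longrightarrow> c \<noteq> b \<Longrightarrow> snd (p c) < H a b (X c)"
      using h by (auto simp: upper_hull_def orient_height_iff)
    have "r \<noteq> a" "r \<noteq> b" using less hab(1) by auto
    then have "snd (p r) < H a b (X r)" using hab(2) D_V[OF n(1)] by auto
    moreover have "nxt l r \<noteq> b" using less by auto
    then have "snd (p (nxt l r)) \<le> H a b (X (nxt l r))"
      using hab D_V[OF n(1)] by (cases "nxt l r = a") (auto simp: less_imp_le)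
    ultimately show False using height_less(1)[OF less hab(1)] A hab(1) by simp
  qed
  show "charge (l, r) \<noteq> (b, False)" if h: "(a, b) \<in> lower_hull"
  proof
    assume "charge (l, r) = (b, False)"
    then have b: "apex l r = b" "apex l r = nxt l r" by (auto simp: charge_def)
    note A = apex_eq_nxt_above[OF e b(2), unfolded b(1)]
    have less: "X l < X b" "X b < X r" using A apex(2)[OF e] b by auto
    have hab: "X a < X b" "\<And>c. c \<in> V \<Longrightarrow> c \<noteq> a \<Longrightarrow> c \<noteq> b \<Longrightarrow> snd (p c) > H a b (X c)"
      using h by (auto simp: lower_hull_def orient_height_iff)
    have "r \<noteq> a" "r \<noteq> b" using less hab(1) by auto
    then have "snd (p r) > H a b (X r)" using hab(2) D_V[OF d] by auto
    moreover have "l \<noteq> b" using less by auto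
    then have "snd (p l) \<ge> H a b (X l)"
      using hab D_V[OF d] by (cases "l = a") (auto simp: less_imp_le)
    ultimately show False using height_less(2)[OF less hab(1)] A hab(1) by simp
  qed
  show "\<exists>v\<in>V. X v < X (apex l r)"
  proof (cases "apex l r = nxt l r")
    case True
    then show ?thesis using apex_eq_nxt_above[OF e] D_V[OF d] by auto
  next
    case False
    then show ?thesis using apex_ne_nxt_below[OF e] D_V[OF n(1)] by auto
  qed
qed

text \<open>Each vertex has two slots. The charged slots, the slots above right ends of upper hull
  edges and those below right ends of lower hull edges are pairwise disjoint, and both slots of the
  leftmost vertex \<open>m\<close> stay free.\<close>

lemma card_lower: "card lower + card upper_hull + card lower_hull + 2 \<le> 2 * card V"
proof -
  obtain m where m: "m \<in> V" "\<And>v. v \<in> V \<Longrightarrow> X m \<le> X v"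
    using arg_min_if_finite[OF fin ne, of X] by (meson not_le)
  define A where "A = charge ` lower"
  define U where "U = (\<lambda>e. (snd e, True)) ` upper_hull"
  define L where "L = (\<lambda>e. (snd e, False)) ` lower_hull"
  have fl: "finite lower" "finite upper_hull" "finite lower_hull"
    using finite_D finite_hull by (auto simp: lower_def intro: finite_subset[of _ D])
  have cards: "card A = card lower" "card U = card upper_hull" "card L = card lower_hull"
    using inj_on_charge inj_on_hull unfolding A_def U_def L_def
    by (auto intro!: card_image simp: inj_on_def)
  have dis: "A \<inter> U = {}" "A \<inter> L = {}" "U \<inter> L = {}"
    using charge_not_hull(1,2) unfolding A_def U_def L_def by (auto, metis+)
  have "v \<noteq> m" if "(v, z) \<in> A \<union> U \<union> L" for v z
    using that charge_not_hull(3) m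
    unfolding A_def U_def L_def charge_def upper_hull_def lower_hull_def by (force simp: not_le[symmetric])
  then have dm: "(A \<union> U \<union> L) \<inter> {(m, True), (m, False)} = {}" by blast
  have "A \<union> U \<union> L \<union> {(m, True), (m, False)} \<subseteq> V \<times> UNIV"
    using apex(1) m unfolding A_def U_def L_def charge_def upper_hull_def lower_hull_def by auto
  then have "card (A \<union> U \<union> L \<union> {(m, True), (m, False)}) \<le> card (V \<times> (UNIV :: bool set))"
    using fin by (intro card_mono) auto
  moreover have "card (A \<union> U \<union> L \<union> {(m, True), (m, False)}) = card (A \<union> U \<union> L) + 2"
    using dm fl by (subst card_Un_disjoint) (auto simp: A_def U_def L_def)
  moreover have "card (A \<union> U \<union> L) = card A + card U + card L"
    using dis fl by (simp add: card_Un_disjoint A_def U_def L_def Int_Un_distrib2)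
  ultimately show ?thesis using cards by (simp add: card_cartesian_product)
qed

text \<open>An edge outside \<open>lower\<close> has the least slope among the left edges of its
  right end, so every vertex has at most one such edge and the leftmost vertex has none.\<close>

lemma card_topmost: "card (D - lower) + 1 \<le> card V"
proof -
  obtain m where m: "m \<in> V" "\<And>v. v \<in> V \<Longrightarrow> X m \<le> X v"
    using arg_min_if_finite[OF fin ne, of X] by (meson not_le)
  have "l1 = l2" if "(l1, r) \<in> D - lower" "(l2, r) \<in> D - lower" for l1 l2 r
  proof -
    have "\<not> S l1 r < S l2 r" "\<not> S l2 r < S l1 r"
      using that by (auto simp: lower_def above_def)
    then show ?thesis using S_inj[of l1 l2 r] that D_V D_less by (metis DiffD1 linorder_neqE)
  qed
  then have "inj_on snd (D - lower)" by (force intro: inj_onI)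
  then have "card (D - lower) = card (snd ` (D - lower))" by (simp add: card_image)
  also have "\<dots> \<le> card (V - {m})"
    using fin D_V D_less m by (intro card_mono) (auto, force)
  finally show ?thesis using m fin by (simp add: card_Diff_singleton) (metis Suc_leI Suc_pred card_gt_0_iff empty_iff le_simps(2) less_Suc_eq_le)
qed

lemma card_edges: "card D + card upper_hull + card lower_hull + 3 \<le> 3 * card V"
proof -
  have "lower \<subseteq> D" by (auto simp: lower_def)
  then have "card D = card lower + card (D - lower)"
    using finite_D by (metis card_Diff_subset card_mono finite_subset le_add_diff_inverse)
  then show ?thesis using card_lower card_topmost by simp
qed

end

section \<open>From left-right drawings to arbitrary plane drawings\<close>

definition edges_on :: "'v set \<Rightarrow> 'v set set" where
  "edges_on V = {{u, v} | u v. u \<in> V \<and> v \<in> V \<and> u \<noteq> v}"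

definition plane_drawing :: "('v \<Rightarrow> real \<times> real) \<Rightarrow> 'v set set \<Rightarrow> bool" where
  "plane_drawing p E \<longleftrightarrow>
     (\<forall>a b c d. {a, b} \<in> E \<longrightarrow> {c, d} \<in> E \<longrightarrow> \<not> crosses (p a) (p b) (p c) (p d))"

text \<open>The other vertices lie to the left, so the arcs run counterclockwise around the convex
  hull.\<close>

definition hull_arcs :: "('v \<Rightarrow> real \<times> real) \<Rightarrow> 'v set \<Rightarrow> ('v \<times> 'v) set" where
  "hull_arcs p V =
     {(a, b). a \<in> V \<and> b \<in> V \<and> a \<noteq> b \<and> (\<forall>c\<in>V - {a, b}. orient (p a) (p b) (p c) > 0)}"

lemma finite_edges_on: "finite V \<Longrightarrow> finite (edges_on V)"
  by (rule finite_subset[of _ "Pow V"]) (auto simp: edges_on_def)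

lemma pair_in_edges_on: "{a, b} \<in> edges_on V \<longleftrightarrow> a \<in> V \<and> b \<in> V \<and> a \<noteq> b"
  by (auto simp: edges_on_def doubleton_eq_iff)

lemma card_edges_on: "finite V \<Longrightarrow> card (edges_on V) = card V choose 2"
proof -
  assume "finite V"
  moreover have "edges_on V = {e. e \<subseteq> V \<and> card e = 2}"
    by (auto simp: edges_on_def card_2_iff)
  ultimately show ?thesis by (simp add: n_subsets)
qed

lemma general_position_inj_on:
  assumes "general_position p V" "card V \<ge> 3"
  shows "inj_on p V"
proof (rule inj_onI, rule ccontr)
  fix a b assume *: "a \<in> V" "b \<in> V" "p a = p b" "a \<noteq> b"
  have "finite V" using assms(2) card.infinite by fastforce
  then have "card {a, b} < card V" using assms(2) * by simp
  then have "\<not> V \<subseteq> {a, b}" by (metis card_mono finite.emptyI finite_insert leD)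
  then obtain c where "c \<in> V" "c \<noteq> a" "c \<noteq> b" by auto
  then show False using general_positionD[OF assms(1) *(1,2), of c] * by simp
qed

text \<open>Two distinct points get the same value for at most one parameter, so all but finitely
  many \<open>t\<close> work.\<close>

lemma generic_direction:
  fixes p :: "'v \<Rightarrow> real \<times> real"
  assumes "finite V" "inj_on p V"
  obtains t where "inj_on (\<lambda>v. fst (p v) + t * snd (p v)) V"
proof -
  \<comment> \<open>Pairs with equal second coordinates contribute 0 through division by zero, which
    only enlarges the finite set to be avoided.\<close>
  define B where "B = (\<lambda>(a, b). (fst (p a) - fst (p b)) / (snd (p b) - snd (p a))) ` (V \<times> V)"
  have "finite B" using assms(1) by (simp add: B_def)
  then obtain t where t: "t \<notin> B" using ex_new_if_finite infinite_UNIV_char_0 by blast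
  have "a = b" if ab: "a \<in> V" "b \<in> V" "fst (p a) + t * snd (p a) = fst (p b) + t * snd (p b)" for a b
  proof (cases "snd (p a) = snd (p b)")
    case True
    then have "p a = p b" using ab by (simp add: prod_eq_iff)
    then show ?thesis using ab assms(2) by (auto dest: inj_onD)
  next
    case False
    then have "t = (fst (p a) - fst (p b)) / (snd (p b) - snd (p a))" using ab(3) by (simp add: field_simps)
    then show ?thesis using t ab unfolding B_def by force
  qed
  then show thesis by (intro that inj_onI) auto
qed

theorem plane_drawing_card_le:
  fixes p :: "'v \<Rightarrow> real \<times> real"
  assumes V: "finite V" "card V \<ge> 3" "general_position p V"
    and E: "E \<subseteq> edges_on V" "plane_drawing p E"
  shows "card E + card (hull_arcs p V) + 3 \<le> 3 * card V"
proof -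
  obtain t where t: "inj_on (\<lambda>v. fst (p v) + t * snd (p v)) V"
    using generic_direction V general_position_inj_on by blast
  \<comment> \<open>A shear has determinant 1, so it changes no orientation and preserves crossings
    and hull arcs.\<close>
  define q where "q v = (fst (p v) + t * snd (p v), snd (p v))" for v
  have or: "orient (q a) (q b) (q c) = orient (p a) (p b) (p c)" for a b c
    by (simp add: q_def orient_def algebra_simps)
  define D where "D = {(l, r). {l, r} \<in> E \<and> fst (q l) < fst (q r)}"
  have inj_x: "inj_on (\<lambda>v. fst (q v)) V" using t by (simp add: q_def)
  interpret left_right_drawing q V D
  proof
    show "finite V" "V \<noteq> {}" using V by auto
    show "general_position q V" using V(3) by (simp add: general_position_def or)
    show "inj_on (\<lambda>v. fst (q v)) V" by fact
    show "D \<subseteq> V \<times> V" using E(1) by (auto simp: D_def pair_in_edges_on dest: subsetD)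
    show "fst (q l) < fst (q r)" if "(l, r) \<in> D" for l r using that by (auto simp: D_def)
    show "\<not> crosses (q a) (q b) (q c) (q d)" if "(a, b) \<in> D" "(c, d) \<in> D" for a b c d
      using that E(2) by (auto simp: D_def plane_drawing_def crosses_def or)
  qed
  have "E \<subseteq> (\<lambda>(l, r). {l, r}) ` D"
  proof
    fix e assume e: "e \<in> E"
    then obtain u v where uv: "e = {u, v}" "u \<in> V" "v \<in> V" "u \<noteq> v" using E(1) by (auto simp: edges_on_def)
    then have "fst (q u) \<noteq> fst (q v)" using inj_x by (auto dest: inj_onD)
    then have "(u, v) \<in> D \<or> (v, u) \<in> D" using e uv by (auto simp: D_def insert_commute)
    then show "e \<in> (\<lambda>(l, r). {l, r}) ` D" using uv(1) by (force simp: insert_commute)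
  qed
  then have "card E \<le> card D"
    using finite_D by (meson card_image_le card_mono finite_imageI le_trans)
  \<comment> \<open>A counterclockwise arc that goes to the right is a lower hull edge; one that
    goes to the left is a reversed upper hull edge.\<close>
  moreover have "hull_arcs p V \<subseteq> lower_hull \<union> prod.swap ` upper_hull"
  proof
    fix e assume "e \<in> hull_arcs p V"
    then obtain a b where e: "e = (a, b)" "a \<in> V" "b \<in> V" "a \<noteq> b"
      and o: "\<And>c. c \<in> V - {a, b} \<Longrightarrow> orient (p a) (p b) (p c) > 0"
      by (auto simp: hull_arcs_def)
    have "fst (q a) \<noteq> fst (q b)" using e inj_x by (auto dest: inj_onD)
    then show "e \<in> lower_hull \<union> prod.swap ` upper_hull"
    proof (cases "fst (q a) < fst (q b)")
      case True
      then show ?thesis using e o by (auto simp: lower_hull_def or)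
    next
      case False
      then have "(b, a) \<in> upper_hull"
        using e o \<open>fst (q a) \<noteq> fst (q b)\<close> orient_swap[of "p b" "p a"]
        by (auto simp: upper_hull_def or)
      then show ?thesis using e by force
    qed
  qed
  then have "card (hull_arcs p V) \<le> card lower_hull + card upper_hull"
    using V(1)
    by (meson card_Un_le card_image_le card_mono finite_UnI finite_imageI finite_hull le_trans add_left_mono)
  ultimately show ?thesis using card_edges by simp
qed

subsection \<open>The convex hull\<close>

text \<open>The points left of the line through z and a are sorted around a by the cotangent of their
  angle to that line.\<close>

lemma first_in_half_plane:
  fixes p :: "'v \<Rightarrow> real \<times> real"
  assumes C: "finite C" "C \<noteq> {}" and left: "\<And>c. c \<in> C \<Longrightarrow> orient z (p a) (p c) > 0"
    and a: "a \<in> V" "a \<notin> C" "C \<subseteq> V" and gp: "general_position p V"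
  obtains b where "b \<in> C" "\<And>c. c \<in> C - {b} \<Longrightarrow> orient (p a) (p b) (p c) > 0"
proof -
  \<comment> \<open>\<open>g c\<close> and \<open>orient z (p a) c\<close> are the dot and cross
    products of the direction from \<open>z\<close> to \<open>p a\<close> with c -
    \<open>p a\<close>. The minus sign in \<open>key\<close> turns the largest cotangent, hence the
    smallest angle, into a minimum. The identity \<open>N\<close> expresses the determinant in these
    rotated coordinates.\<close>
  define g where "g c = (fst (p a) - fst z) * (fst c - fst (p a)) + (snd (p a) - snd z) * (snd c - snd (p a))"
    for c :: "real \<times> real"
  define key where "key c = - g (p c) / orient z (p a) (p c)" for c
  define N where "N = (fst (p a) - fst z)\<^sup>2 + (snd (p a) - snd z)\<^sup>2"
  have N: "N * orient (p a) b c = g b * orient z (p a) c - g c * orient z (p a) b" for b c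
    by (simp add: N_def g_def orient_def power2_eq_square algebra_simps)
  define b where "b = arg_min_on key C"
  have b: "b \<in> C" "\<And>c. c \<in> C \<Longrightarrow> key b \<le> key c"
    using arg_min_if_finite[OF C, of key] unfolding b_def by (auto simp: not_less)
  have "orient (p a) (p b) (p c) > 0" if c: "c \<in> C - {b}" for c
  proof -
    have "g (p c) * orient z (p a) (p b) \<le> g (p b) * orient z (p a) (p c)"
      using b(2)[of c] left[OF b(1)] left[of c] c by (simp add: key_def field_simps)
    then have "N * orient (p a) (p b) (p c) \<ge> 0" using N by simp
    moreover have "N > 0"
      using left[OF b(1)] unfolding N_def by (auto simp: orient_def sum_power2_gt_zero_iff)
    moreover have "orient (p a) (p b) (p c) \<noteq> 0"
      using general_positionD[OF gp] a b(1) c by (metis DiffE singletonI subsetD)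
    ultimately show ?thesis by (simp add: zero_le_mult_iff)
  qed
  then show thesis using that b(1) by blast
qed

lemma hull_arcs_iff:
  "(a, b) \<in> hull_arcs p V \<longleftrightarrow>
     a \<in> V \<and> b \<in> V \<and> a \<noteq> b \<and> (\<forall>c\<in>V - {a, b}. orient (p a) (p b) (p c) > 0)"
  by (simp add: hull_arcs_def)

context
  fixes p :: "'v \<Rightarrow> real \<times> real" and V :: "'v set"
  assumes V: "finite V" "card V \<ge> 3" and gp: "general_position p V"
begin

lemma exists_third: "\<exists>c\<in>V. c \<noteq> a \<and> c \<noteq> b"
proof -
  have "card {a, b} < card V" using V(2) card_insert_le_m1[of 2 "{b}" a] by simp
  then have "\<not> V \<subseteq> {a, b}" by (metis card_mono finite.emptyI finite_insert leD)
  then show ?thesis by auto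
qed

lemma hull_arc_exists: "\<exists>a b. (a, b) \<in> hull_arcs p V"
proof -
  obtain t where t: "inj_on (\<lambda>v. fst (p v) + t * snd (p v)) V"
    using generic_direction V gp general_position_inj_on by blast
  define \<phi> where "\<phi> v = fst (p v) + t * snd (p v)" for v
  have "V \<noteq> {}" using V by auto
  then obtain a where a: "a \<in> V" "\<And>v. v \<in> V \<Longrightarrow> \<phi> a \<le> \<phi> v"
    using arg_min_if_finite[OF V(1), of \<phi>] by (meson not_le)
  \<comment> \<open>\<open>z\<close> is shifted from \<open>p a\<close> along the level line of
    \<phi>, which makes \<open>orient z (p a) (p c)\<close> equal to \<phi> c - \<phi> a.\<close>
  define z where "z = (fst (p a) - t, snd (p a) + 1)"
  have "orient z (p a) (p c) > 0" if "c \<in> V - {a}" for c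
  proof -
    have "\<phi> a \<noteq> \<phi> c" using t a(1) that by (auto simp: \<phi>_def dest: inj_onD)
    then have "\<phi> a < \<phi> c" using a(2)[of c] that by simp
    then show ?thesis by (simp add: z_def orient_def \<phi>_def algebra_simps)
  qed
  moreover have "V - {a} \<noteq> {}" using exists_third[of a a] by auto
  ultimately obtain b where "b \<in> V - {a}" "\<And>c. c \<in> V - {a} - {b} \<Longrightarrow> orient (p a) (p b) (p c) > 0"
    using first_in_half_plane[of "V - {a}" z p a V] V(1) a(1) gp by blast
  then show ?thesis using a(1) by (auto simp: hull_arcs_iff)
qed

text \<open>Gift wrapping: all other vertices lie left of the arc from \<open>z\<close> to
  \<open>a\<close>, and the first one met when turning around \<open>a\<close> is the successor.
  That \<open>z\<close> also lies left of the new arc follows by cyclic rotation.\<close>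

lemma hull_arc_next:
  assumes "(z, a) \<in> hull_arcs p V"
  shows "\<exists>b. (a, b) \<in> hull_arcs p V"
proof -
  have z: "z \<in> V" "a \<in> V" "z \<noteq> a" "\<And>c. c \<in> V - {z, a} \<Longrightarrow> orient (p z) (p a) (p c) > 0"
    using assms by (auto simp: hull_arcs_iff)
  have ne: "V - {z, a} \<noteq> {}" using exists_third[of z a] by auto
  have "finite (V - {z, a})" "a \<notin> V - {z, a}" "V - {z, a} \<subseteq> V" using V(1) by auto
  then obtain b where b: "b \<in> V - {z, a}" "\<And>c. c \<in> V - {z, a} - {b} \<Longrightarrow> orient (p a) (p b) (p c) > 0"
    using first_in_half_plane[of "V - {z, a}" "p z" p a V, OF _ ne z(4) z(2) _ _ gp] by blast
  have "orient (p a) (p b) (p z) > 0" using z(4)[OF b(1)] orient_rotate by metis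
  then have "orient (p a) (p b) (p c) > 0" if "c \<in> V - {a, b}" for c
    using b(2)[of c] that by (cases "c = z") auto
  then show ?thesis using z b(1) by (auto simp: hull_arcs_iff)
qed

lemma hull_arc_pred_unique:
  assumes "(a, b) \<in> hull_arcs p V" "(c, b) \<in> hull_arcs p V"
  shows "a = c"
proof (rule ccontr)
  assume "a \<noteq> c"
  then have "orient (p a) (p b) (p c) > 0" "orient (p c) (p b) (p a) > 0"
    using assms by (auto simp: hull_arcs_iff)
  moreover have "orient (p c) (p b) (p a) = - orient (p a) (p b) (p c)"
    by (simp add: orient_def algebra_simps)
  ultimately show False by simp
qed

lemma hull_arc_asym:
  assumes "(a, b) \<in> hull_arcs p V"
  shows "(b, a) \<notin> hull_arcs p V"
proof
  assume *: "(b, a) \<in> hull_arcs p V"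
  obtain c where "c \<in> V" "c \<noteq> a" "c \<noteq> b" using exists_third by blast
  then have "orient (p a) (p b) (p c) > 0" "orient (p b) (p a) (p c) > 0"
    using assms * by (auto simp: hull_arcs_iff)
  then show False using orient_swap[of "p a" "p b" "p c"] by simp
qed

lemma finite_hull_arcs: "finite (hull_arcs p V)"
  by (rule finite_subset[of _ "V \<times> V"]) (auto simp: hull_arcs_def V(1))

text \<open>Five successive arcs are followed. A return to the start after three or four of them
  gives the first two cases; otherwise asymmetry and unique predecessors make the first five
  vertices distinct. Lower bounds on the number of arcs suffice, since more hull arcs only sharpen
  the edge bound.\<close>

lemma hull_cases:
  obtains (triangle) a b c where "(a, b) \<in> hull_arcs p V" "(b, c) \<in> hull_arcs p V" "(c, a) \<in> hull_arcs p V"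
    "card (hull_arcs p V) \<ge> 3"
  | (quadrilateral) a b c d where "(a, b) \<in> hull_arcs p V" "(b, c) \<in> hull_arcs p V"
    "(c, d) \<in> hull_arcs p V" "(d, a) \<in> hull_arcs p V" "distinct [a, b, c, d]"
    "card (hull_arcs p V) \<ge> 4"
  | (large) "card (hull_arcs p V) \<ge> 5"
proof -
  let ?H = "hull_arcs p V"
  have card: "card A \<le> card ?H" if "A \<subseteq> ?H" for A
    using that finite_hull_arcs by (rule card_mono[rotated])
  obtain a b where ab: "(a, b) \<in> ?H" using hull_arc_exists by blast
  then obtain c where bc: "(b, c) \<in> ?H" using hull_arc_next by blast
  then obtain d where cd: "(c, d) \<in> ?H" using hull_arc_next by blast
  then obtain e where de: "(d, e) \<in> ?H" using hull_arc_next by blast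
  then obtain f where ef: "(e, f) \<in> ?H" using hull_arc_next by blast
  have loop: "u \<noteq> v" if "(u, v) \<in> ?H" for u v using that by (simp add: hull_arcs_iff)
  have two: "u \<noteq> w" if "(u, v) \<in> ?H" "(v, w) \<in> ?H" for u v w using that hull_arc_asym by blast
  have ne: "a \<noteq> b" "b \<noteq> c" "c \<noteq> d" "d \<noteq> e" "a \<noteq> c" "b \<noteq> d" "c \<noteq> e"
    using loop two ab bc cd de by metis+
  show thesis
  proof (cases "d = a")
    case True
    have "card {(a, b), (b, c), (c, a)} \<le> card ?H" using True ab bc cd by (intro card) auto
    then show thesis using triangle[of a b c] True ab bc cd ne by simp
  next
    case da: False
    show thesis
    proof (cases "e = a")
      case True
      have "card {(a, b), (b, c), (c, d), (d, a)} \<le> card ?H" using True ab bc cd de by (intro card) auto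
      then show thesis using quadrilateral[of a b c d] True ab bc cd de ne da by auto
    next
      case False
      have "e \<noteq> b" using hull_arc_pred_unique ab de da by blast
      moreover have "card {(a, b), (b, c), (c, d), (d, e), (e, f)} \<le> card ?H"
        using ab bc cd de ef by (intro card) auto
      ultimately show thesis using large ne da False by auto
    qed
  qed
qed

end

subsection \<open>Uncrossed edges\<close>

definition uncrossed_edges :: "('v \<Rightarrow> real \<times> real) \<Rightarrow> 'v set \<Rightarrow> 'v set set" where
  "uncrossed_edges p V = {{a, b} | a b. a \<in> V \<and> b \<in> V \<and> a \<noteq> b \<and>
     (\<forall>c\<in>V. \<forall>d\<in>V. \<not> crosses (p a) (p b) (p c) (p d))}"

lemma uncrossed_edges_subset: "uncrossed_edges p V \<subseteq> edges_on V"
  unfolding uncrossed_edges_def edges_on_def by blast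

lemma plane_drawing_insertI:
  assumes E: "plane_drawing p E" and new: "\<And>c d. {c, d} \<in> E \<Longrightarrow> \<not> crosses (p a) (p b) (p c) (p d)"
  shows "plane_drawing p (insert {a, b} E)"
  unfolding plane_drawing_def
proof (intro allI impI)
  have self: "\<not> crosses u v u v" for u v :: "real \<times> real" by (simp add: crosses_def)
  have flip: "crosses (p x) (p y) u v \<longleftrightarrow> crosses (p a) (p b) u v" if "{x, y} = {a, b}" for x y u v
    using that crosses_flip by (metis doubleton_eq_iff)
  fix c d e f assume "{c, d} \<in> insert {a, b} E" "{e, f} \<in> insert {a, b} E"
  then show "\<not> crosses (p c) (p d) (p e) (p f)"
    using flip self new E crosses_commute unfolding plane_drawing_def by (metis insertE)
qed

lemma plane_drawing_Un_uncrossed: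
  assumes V: "finite V" and E: "plane_drawing p E" "E \<subseteq> edges_on V" and U: "U \<subseteq> uncrossed_edges p V"
  shows "plane_drawing p (E \<union> U)"
proof -
  have "finite U" using U uncrossed_edges_subset V finite_edges_on by (metis finite_subset)
  then have "plane_drawing p (U \<union> E)" using U
  proof (induction U)
    case (insert e U)
    then obtain a b where e: "e = {a, b}" "\<And>c d. c \<in> V \<Longrightarrow> d \<in> V \<Longrightarrow> \<not> crosses (p a) (p b) (p c) (p d)"
      by (auto simp: uncrossed_edges_def)
    have "U \<union> E \<subseteq> edges_on V" using insert.prems E(2) uncrossed_edges_subset by (metis insert_subset subset_trans Un_least)
    then have "\<not> crosses (p a) (p b) (p c) (p d)" if "{c, d} \<in> U \<union> E" for c d
      using that e(2) by (metis pair_in_edges_on subsetD)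
    then show ?case using plane_drawing_insertI[of p "U \<union> E" a b] insert e(1) by auto
  qed (use E in simp)
  then show ?thesis by (simp add: Un_commute)
qed

lemma hull_arc_uncrossed: "(a, b) \<in> hull_arcs p V \<Longrightarrow> {a, b} \<in> uncrossed_edges p V"
proof -
  assume h: "(a, b) \<in> hull_arcs p V"
  have "orient (p a) (p b) (p c) \<ge> 0" if "c \<in> V" for c
    using h that by (cases "c = a \<or> c = b") (auto simp: hull_arcs_iff less_imp_le)
  then have "\<not> crosses (p a) (p b) (p c) (p d)" if "c \<in> V" "d \<in> V" for c d
    using that by (simp add: crosses_def not_less)
  then show ?thesis using h by (auto simp: uncrossed_edges_def hull_arcs_iff)
qed

text \<open>Along the segment aq, the distance from the line bc stays at least that of q, so a segment crossing it
  has an endpoint that is farther from bc than q.\<close>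

lemma crosses_far_endpoint:
  fixes a q u v b c :: "real \<times> real"
  assumes cr: "crosses a q u v" and bc: "b \<noteq> c" and aq: "orient b c q \<le> orient b c a"
  shows "orient b c q < orient b c u \<or> orient b c q < orient b c v"
proof (rule ccontr)
  assume "\<not> ?thesis"
  then have le: "orient b c u \<le> orient b c q" "orient b c v \<le> orient b c q" by auto
  have ne: "orient a q u \<noteq> 0" "orient a q v \<noteq> 0" "orient u v q \<noteq> 0"
    using cr by (auto simp: crosses_def)
  have level: "orient b c x \<noteq> orient b c q" if "orient b c a = orient b c q" "orient a q x \<noteq> 0" for x
  proof
    assume "orient b c x = orient b c q"
    then have "(fst c - fst b) * orient a q x = 0" "(snd c - snd b) * orient a q x = 0"
      using that(1) unfolding orient_def by algebra+
    then show False using bc that(2) by (simp add: prod_eq_iff)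
  qed
  obtain s t where st: "0 \<le> s" "s \<le> 1" "0 \<le> t" "t \<le> 1"
    and eq: "(1 - s) *\<^sub>R a + s *\<^sub>R q = (1 - t) *\<^sub>R u + t *\<^sub>R v"
    using crosses_imp_meet[OF cr] by (metis disjoint_iff in_segment(1))
  have "(1 - s) * orient b c a + s * orient b c q = (1 - t) * orient b c u + t * orient b c v"
    using orient_affine[of b c s a q] orient_affine[of b c t u v] eq by simp
  \<comment> \<open>By the negated goal all summands are nonnegative, so each of them vanishes. This
    puts \<open>q\<close> on the line uv, or \<open>u\<close> or \<open>v\<close> on the line aq,
    both excluded by \<open>ne\<close>.\<close>
  then have sum: "(1 - s) * (orient b c a - orient b c q)
      + ((1 - t) * (orient b c q - orient b c u) + t * (orient b c q - orient b c v)) = 0"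
    by (simp add: algebra_simps)
  have nonneg: "0 \<le> (1 - s) * (orient b c a - orient b c q)" "0 \<le> (1 - t) * (orient b c q - orient b c u)"
    "0 \<le> t * (orient b c q - orient b c v)" using st aq le by simp_all
  show False
  proof (cases "orient b c a = orient b c q")
    case False
    then have "s = 1" using sum nonneg by (smt (verit) mult_eq_0_iff)
    then have "q = (1 - t) *\<^sub>R u + t *\<^sub>R v" using eq by simp
    then show False using ne(3) orient_affine[of u v t u v] by simp
  next
    case True
    then show False using sum nonneg level[OF True ne(1)] level[OF True ne(2)]
      by (smt (verit) mult_eq_0_iff)
  qed
qed

text \<open>Around both a and b, the direction of q separates those of x and y.\<close>

lemma crosses_zigzag:
  fixes a b q x y :: "real \<times> real"
  assumes "crosses a q b y" "crosses b q a x"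
  shows "crosses a x b y"
proof -
  \<comment> \<open>Exchanging (a, x) with (b, y) reverses the orientation of a, b, q, so it may be
    taken positive.\<close>
  have pos: "crosses a x b y" if cr: "crosses a q b y" "crosses b q a x" and ab: "orient a b q > 0"
    for a b q x y :: "real \<times> real"
  proof -
    have r: "orient a q b = - orient a b q" "orient b q a = orient a b q" "orient b y a = orient a b y"
      "orient a x b = - orient a b x" "orient b y x = - orient b x y"
      by (simp_all add: orient_def algebra_simps)
    have q: "orient a q y > 0" "orient b q x < 0"
      using cr ab by (auto simp: crosses_def r mult_less_0_iff zero_less_mult_iff)
    have "orient a b y + orient b q y + orient q a y = orient a b q"
      "orient a b x + orient b q x + orient q a x = orient a b q"
      "orient b y q = - orient b q y" "orient q a y = - orient a q y"
      "orient a x q = orient q a x"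
      by (simp_all add: orient_def algebra_simps)
    then have y: "orient a b y > 0" "orient b q y > 0" and x: "orient a b x > 0" "orient a x q > 0"
      using cr ab q by (auto simp: crosses_def r mult_less_0_iff zero_less_mult_iff)
    \<comment> \<open>Three-term Grassmann-Pluecker relations at \<open>a\<close> and at
      \<open>b\<close>, with both products on each right-hand side positive.\<close>
    have "orient a b q * orient a x y = orient a b x * orient a q y + orient a b y * orient a x q"
      "orient a b q * orient b x y = orient a b x * orient b q y + orient a b y * (- orient b q x)"
      by (simp_all add: orient_def algebra_simps)
    then have "orient a b q * orient a x y > 0" "orient a b q * orient b x y > 0"
      using mult_pos_pos[OF x(1) q(1)] mult_pos_pos[OF y(1) x(2)] mult_pos_pos[OF x(1) y(2)]
        mult_pos_neg[OF y(1) q(2)] by linarith+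
    then have "orient a x y > 0" "orient b x y > 0" using ab by (simp_all add: zero_less_mult_iff)
    then show ?thesis using x y by (simp add: crosses_def r)
  qed
  have "orient a q b \<noteq> 0" using assms(1) by (auto simp: crosses_def)
  then consider "orient a b q > 0" | "orient b a q > 0"
    by (simp add: orient_def algebra_simps) linarith
  then show ?thesis
    using pos[of a q b y x] pos[of b q a x y] assms crosses_commute by cases blast+
qed

text \<open>If neither edge could be added, both would be crossed by edges of the drawing at the
  other one of a and a', and these two edges would cross each other.\<close>

lemma plane_drawing_insert_either:
  assumes E: "plane_drawing p E" "E \<subseteq> edges_on V"
    and bc: "p b \<noteq> p c"
    and far: "\<And>v. v \<in> V - {a, a'} \<Longrightarrow> orient (p b) (p c) (p v) \<le> orient (p b) (p c) (p q)"
    and le: "orient (p b) (p c) (p q) \<le> orient (p b) (p c) (p a)"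
      "orient (p b) (p c) (p q) \<le> orient (p b) (p c) (p a')"
  shows "plane_drawing p (insert {a, q} E) \<or> plane_drawing p (insert {a', q} E)"
proof -
  \<comment> \<open>Only \<open>a\<close> and \<open>a'\<close> can be farther from the line bc than
    \<open>q\<close>, and a segment crossing zq does not end at z. So one of its ends is
    \<open>w\<close>.\<close>
  have other: "\<exists>y. {w, y} \<in> E \<and> crosses (p z) (p q) (p w) (p y)"
    if cr: "{u, v} \<in> E" "crosses (p z) (p q) (p u) (p v)" and zw: "{z, w} = {a, a'}" for u v z w
  proof -
    have V: "u \<in> V" "v \<in> V" using cr(1) E(2) pair_in_edges_on by (metis subsetD)+
    have "z \<in> {a, a'}" using zw by auto
    then have "orient (p b) (p c) (p q) \<le> orient (p b) (p c) (p z)" using le by auto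
    then have "u \<in> {z, w} \<or> v \<in> {z, w}"
      using crosses_far_endpoint[OF cr(2) bc] far V zw by (metis Diff_iff not_le)
    moreover have "u \<noteq> z" "v \<noteq> z" using cr(2) by (auto simp: crosses_def)
    ultimately consider "u = w" | "v = w" by auto
    then show ?thesis
    proof cases
      case 2
      then show ?thesis using cr crosses_flip_right by (metis insert_commute)
    qed (use cr in blast)
  qed
  show ?thesis
  proof (rule ccontr)
    assume "\<not> ?thesis"
    then obtain u v u' v' where "{u, v} \<in> E" "crosses (p a) (p q) (p u) (p v)"
      "{u', v'} \<in> E" "crosses (p a') (p q) (p u') (p v')"
      using plane_drawing_insertI[OF E(1)] by metis
    then obtain x y where "{a', y} \<in> E" "crosses (p a) (p q) (p a') (p y)"
      "{a, x} \<in> E" "crosses (p a') (p q) (p a) (p x)"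
      using other[of u v a a'] other[of u' v' a' a] by auto
    then show False using crosses_zigzag E(1) unfolding plane_drawing_def by blast
  qed
qed

text \<open>A segment crossing the edge from b to the vertex b' farthest from ca would have an endpoint
  farther from ca than b', which can only be b.\<close>

lemma corner_edge:
  assumes V: "finite V" and h: "(a, b) \<in> hull_arcs p V" "(b, c) \<in> hull_arcs p V" and ac: "a \<noteq> c"
    and w: "w \<in> V" "w \<noteq> b" "orient (p c) (p a) (p w) > 0"
  obtains b' where "b' \<in> V - {a, b, c}" "orient (p c) (p a) (p b') > 0" "{b, b'} \<in> uncrossed_edges p V"
    "\<And>v. v \<in> V - {b} \<Longrightarrow> orient (p c) (p a) (p v) \<le> orient (p c) (p a) (p b')"
    "\<And>v. v \<in> V - {b} \<Longrightarrow> orient (p c) (p a) (p v) < orient (p c) (p a) (p b)"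
proof -
  define f where "f v = orient (p c) (p a) (p v)" for v
  have abc: "a \<in> V" "b \<in> V" "c \<in> V" "a \<noteq> b" "b \<noteq> c"
    and hull: "\<And>v. v \<in> V - {a, b} \<Longrightarrow> orient (p a) (p b) (p v) > 0"
      "\<And>v. v \<in> V - {b, c} \<Longrightarrow> orient (p b) (p c) (p v) > 0"
    using h by (auto simp: hull_arcs_iff)
  have f0: "f a = 0" "f c = 0" by (simp_all add: f_def)
  have fb: "f b > 0" using hull(1)[of c] abc ac orient_rotate[of "p a" "p b" "p c"]
    orient_rotate[of "p b" "p c" "p a"] by (simp add: f_def)
  have max: "f v < f b" if v: "v \<in> V - {b}" for v
  proof (cases "v \<in> {a, c}")
    case True
    then show ?thesis using f0 fb by auto
  next
    case False
    \<comment> \<open>The signed areas that v spans with the three sides add up to the area of abc,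
      and those at the two hull arcs are positive.\<close>
    have "orient (p a) (p b) (p v) + orient (p b) (p c) (p v) + f v = f b"
      by (simp add: f_def orient_def algebra_simps)
    then show ?thesis using hull(1)[of v] hull(2)[of v] v False by auto
  qed
  define b' where "b' = arg_min_on (\<lambda>v. - f v) (V - {b})"
  have "finite (V - {b})" "V - {b} \<noteq> {}" using V w by auto
  from arg_min_if_finite[OF this, of "\<lambda>v. - f v"]
  have b': "b' \<in> V - {b}" "\<And>v. v \<in> V - {b} \<Longrightarrow> f v \<le> f b'"
    unfolding b'_def by (auto simp: not_less)
  have pos: "f b' > 0" using b'(2)[of w] w by (simp add: f_def)
  then have in': "b' \<in> V - {a, b, c}" using b'(1) f0 by auto
  have "\<not> crosses (p b) (p b') (p u) (p v)" if "u \<in> V" "v \<in> V" for u v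
  proof
    assume cr: "crosses (p b) (p b') (p u) (p v)"
    then have "u \<noteq> b" "v \<noteq> b" by (auto simp: crosses_def)
    moreover have "p c \<noteq> p a" using fb by (auto simp: f_def orient_def)
    then have "f b' < f u \<or> f b' < f v"
      using crosses_far_endpoint[OF cr] max[OF b'(1)] unfolding f_def by (simp add: less_imp_le)
    ultimately show False using b'(2)[of u] b'(2)[of v] that by auto
  qed
  then have "{b, b'} \<in> uncrossed_edges p V" using in' abc by (auto simp: uncrossed_edges_def)
  then show thesis using that[OF in'] pos b'(2) max unfolding f_def by blast
qed

section \<open>Summing the edge bound over overlapping layers\<close>

context
  fixes p :: "'v \<Rightarrow> real \<times> real" and V :: "'v set" and L :: "nat \<Rightarrow> 'v set set" and k :: nat
  assumes V: "finite V" "card V \<ge> 3" and gp: "general_position p V"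
    and L: "(\<Union>i<k. L i) = edges_on V" "\<And>i. i < k \<Longrightarrow> plane_drawing p (L i)"
begin

lemma L_sub: "i < k \<Longrightarrow> L i \<subseteq> edges_on V" using L(1) by blast

lemma sum_layers_ge:
  assumes "finite W"
  shows "card (edges_on V) \<le> (\<Sum>i<k. card (L i - W)) + card W"
proof -
  have "edges_on V \<subseteq> (\<Union>i<k. L i - W) \<union> W" using L(1) by auto
  moreover have fin: "finite (\<Union>i<k. L i - W)"
    using finite_subset[OF L_sub finite_edges_on[OF V(1)]] by auto
  ultimately have "card (edges_on V) \<le> card ((\<Union>i<k. L i - W) \<union> W)"
    using assms by (intro card_mono) auto
  also have "\<dots> \<le> card (\<Union>i<k. L i - W) + card W" by (rule card_Un_le)
  also have "card (\<Union>i<k. L i - W) \<le> (\<Sum>i<k. card (L i - W))" by (rule card_UN_le) simp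
  finally show ?thesis by simp
qed

text \<open>Every layer stays plane when all of \<open>U\<close> is added, so the edge bound holds
  for the enlarged layers. In their sum each edge of \<open>U\<close> counts \<open>k\<close> times
  and every other edge at least once.\<close>

lemma layers_uncrossed_bound:
  assumes U: "U \<subseteq> uncrossed_edges p V"
  shows "card (edges_on V) + k * card U + k * (card (hull_arcs p V) + 3) \<le> 3 * k * card V + card U"
proof -
  have U_sub: "U \<subseteq> edges_on V" using U uncrossed_edges_subset by (rule subset_trans)
  have fU: "finite U" using U_sub finite_edges_on[OF V(1)] by (rule finite_subset)
  have "card (L i - U) + card U + (card (hull_arcs p V) + 3) \<le> 3 * card V" if i: "i < k" for i
  proof -
    have "card (L i \<union> U) = card (L i - U) + card U"
      using fU finite_subset[OF L_sub[OF i] finite_edges_on[OF V(1)]]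
      by (metis Diff_disjoint Un_Diff_cancel2 card_Un_disjoint finite_Diff inf_commute)
    then show ?thesis
      using plane_drawing_card_le[OF V gp, of "L i \<union> U"] L_sub[OF i] U_sub
        plane_drawing_Un_uncrossed[OF V(1) L(2)[OF i] L_sub[OF i] U] by simp
  qed
  then have "(\<Sum>i<k. card (L i - U) + card U + (card (hull_arcs p V) + 3)) \<le> (\<Sum>i<k. 3 * card V)"
    by (intro sum_mono) simp
  then show ?thesis using sum_layers_ge[OF fU] by (simp add: sum.distrib algebra_simps)
qed

text \<open>Each enlarged layer can also take \<open>e\<close> or \<open>e'\<close>, so within
  \<open>U\<close> and these two edges it has at least \<open>card U + 1\<close> edges. The pair
  thus contributes at least \<open>k\<close> to the sum, but only 2 to the edges to be
  covered.\<close>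

lemma layers_uncrossed_bound_either:
  assumes U: "U \<subseteq> uncrossed_edges p V"
    and e: "e \<in> edges_on V - U" "e' \<in> edges_on V - U" "e \<noteq> e'"
    and either: "\<And>E. plane_drawing p E \<Longrightarrow> E \<subseteq> edges_on V \<Longrightarrow>
      plane_drawing p (insert e E) \<or> plane_drawing p (insert e' E)"
  shows "card (edges_on V) + k * (card U + 1) + k * (card (hull_arcs p V) + 3) \<le> 3 * k * card V + card U + 2"
proof -
  have U_sub: "U \<subseteq> edges_on V" using U uncrossed_edges_subset by (rule subset_trans)
  have fU: "finite U" using U_sub finite_edges_on[OF V(1)] by (rule finite_subset)
  let ?W = "U \<union> {e, e'}"
  have W: "finite ?W" "card ?W = card U + 2" using fU e by (auto simp: card_Un_disjoint)
  have "card (L i - ?W) + (card U + 1) + (card (hull_arcs p V) + 3) \<le> 3 * card V" if i: "i < k" for i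
  proof -
    have fL: "finite (L i)" using finite_subset[OF L_sub[OF i] finite_edges_on[OF V(1)]] .
    have "plane_drawing p (L i \<union> U)"
      using plane_drawing_Un_uncrossed[OF V(1) L(2)[OF i] L_sub[OF i] U] .
    then obtain g where g: "g \<in> {e, e'}" "plane_drawing p (insert g (L i \<union> U))"
      using either L_sub[OF i] U_sub by (metis Un_least insertCI)
    have "card (L i - ?W) + (card U + 1) = card ((L i - ?W) \<union> insert g U)"
      using fU fL g(1) e by (subst card_Un_disjoint) auto
    also have "\<dots> \<le> card (insert g (L i \<union> U))" using fU fL by (intro card_mono) auto
    finally show ?thesis
      using plane_drawing_card_le[OF V gp _ g(2)] L_sub[OF i] U_sub g(1) e by auto
  qed
  then have "(\<Sum>i<k. card (L i - ?W) + (card U + 1) + (card (hull_arcs p V) + 3)) \<le> (\<Sum>i<k. 3 * card V)"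
    by (intro sum_mono) simp
  then show ?thesis using sum_layers_ge[OF W(1)] W(2) by (simp add: sum.distrib algebra_simps)
qed

end

lemma card_undirected_hull:
  assumes "finite V" "card V \<ge> 3" "general_position p V"
  shows "card ((\<lambda>(a, b). {a, b}) ` hull_arcs p V) = card (hull_arcs p V)"
proof (rule card_image, rule inj_onI, clarify)
  fix a b c d assume h: "(a, b) \<in> hull_arcs p V" "(c, d) \<in> hull_arcs p V" "{a, b} = {c, d}"
  then show "a = c \<and> b = d"
    using hull_arc_asym[OF assms, of a b] by (auto simp: doubleton_eq_iff)
qed

theorem no_three_plane_layers:
  fixes p :: "'v \<Rightarrow> real \<times> real" and V :: "'v set"
  assumes V: "finite V" "card V = 15" and gp: "general_position p V"
    and L: "(\<Union>i<3. L i) = edges_on V" "\<And>i. i < (3::nat) \<Longrightarrow> plane_drawing p (L i)"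
  shows False
proof -
  have V3: "card V \<ge> 3" using V by simp
  have N: "card (edges_on V) = 105" using V by (simp add: card_edges_on choose_two)
  \<comment> \<open>With h hull arcs and u edges in \<open>U\<close> the count reads 105 + 3u + 3(h
    + 3) <= 135 + u.\<close>
  have bound: "2 * card U + 3 * card (hull_arcs p V) \<le> 21" if "U \<subseteq> uncrossed_edges p V" for U
    using layers_uncrossed_bound[OF V(1) V3 gp L(1) _ that] L(2) N V(2) by simp
  show False
    using V(1) V3 gp
  proof (cases rule: hull_cases)
    case large
    have "(\<lambda>(a, b). {a, b}) ` hull_arcs p V \<subseteq> uncrossed_edges p V"
      using hull_arc_uncrossed by auto
    from bound[OF this] show False using large card_undirected_hull[OF V(1) V3 gp] by simp
  next
    case (quadrilateral a b c d)
    have "card {a, b, c, d} < card V" using V(2) quadrilateral(5) by simp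
    then have "\<not> V \<subseteq> {a, b, c, d}" by (metis card_mono finite.emptyI finite_insert leD)
    then obtain w where w: "w \<in> V" "w \<notin> {a, b, c, d}" by auto
    \<comment> \<open>The diagonal ac separates the corners \<open>b\<close> and \<open>d\<close>;
      the additional edge is taken at the corner on the side of the fifth vertex
      \<open>w\<close>.\<close>
    have "orient (p c) (p a) (p w) \<noteq> 0"
      using general_positionD[OF gp, of c a w] w quadrilateral by (auto simp: hull_arcs_iff)
    then consider "orient (p c) (p a) (p w) > 0" | "orient (p a) (p c) (p w) > 0"
      using orient_swap[of "p a" "p c" "p w"] by linarith
    moreover have ne: "a \<noteq> c" "w \<noteq> b" "c \<noteq> a" "w \<noteq> d" using w quadrilateral(5) by auto
    ultimately obtain e where e: "e \<in> uncrossed_edges p V" "e \<notin> {{a, b}, {b, c}, {c, d}, {d, a}}"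
    proof cases
      case 1
      obtain b' where "b' \<in> V - {a, b, c}" "{b, b'} \<in> uncrossed_edges p V"
        by (rule corner_edge[OF V(1) quadrilateral(1,2) ne(1) w(1) ne(2) 1]) (rule that)
      then show thesis using that[of "{b, b'}"] quadrilateral(5) by (auto simp: doubleton_eq_iff)
    next
      case 2
      obtain d' where "d' \<in> V - {c, d, a}" "{d, d'} \<in> uncrossed_edges p V"
        by (rule corner_edge[OF V(1) quadrilateral(3,4) ne(3) w(1) ne(4) 2]) (rule that)
      then show thesis using that[of "{d, d'}"] quadrilateral(5) by (auto simp: doubleton_eq_iff)
    qed
    let ?es = "[e, {a, b}, {b, c}, {c, d}, {d, a}]"
    define U where "U = set ?es"
    have U: "U \<subseteq> uncrossed_edges p V"
      using e(1) quadrilateral(1-4) hull_arc_uncrossed by (auto simp: U_def)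
    have "distinct ?es" using e(2) quadrilateral(5) by (auto simp: doubleton_eq_iff)
    from distinct_card[OF this] have "card U = 5" by (simp only: U_def) simp
    then show False using bound[OF U] quadrilateral(6) by simp
  next
    case (triangle a b c)
    have abc: "a \<in> V" "b \<in> V" "c \<in> V" "a \<noteq> b" "b \<noteq> c" "a \<noteq> c"
      using triangle(1-3) by (auto simp: hull_arcs_iff)
    have inner: "orient (p a) (p b) (p v) > 0" "orient (p b) (p c) (p v) > 0" "orient (p c) (p a) (p v) > 0"
      if "v \<in> V - {a, b, c}" for v
      using that triangle(1-3) by (auto simp: hull_arcs_iff)
    have more: "\<exists>w\<in>V. w \<notin> {a, b, c, x}" for x
    proof -
      have "card {a, b, c, x} < card V"
        using V(2) card_length[of "[a, b, c, x]"] by simp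
      then have "\<not> V \<subseteq> {a, b, c, x}" by (metis card_mono finite.emptyI finite_insert leD)
      then show ?thesis by auto
    qed
    obtain w where w: "w \<in> V - {a, b, c}" using more[of a] by auto
    then have wV: "w \<in> V" "w \<noteq> a" "w \<noteq> b" "w \<noteq> c" by auto
    have ne: "c \<noteq> b" "a \<noteq> c" "b \<noteq> a" using abc by auto
    obtain a' where a': "a' \<in> V - {c, a, b}" "{a, a'} \<in> uncrossed_edges p V"
      and a'_max: "\<And>v. v \<in> V - {a} \<Longrightarrow> orient (p b) (p c) (p v) \<le> orient (p b) (p c) (p a')"
      and a_max: "\<And>v. v \<in> V - {a} \<Longrightarrow> orient (p b) (p c) (p v) < orient (p b) (p c) (p a)"
      by (rule corner_edge[OF V(1) triangle(3,1) ne(1) wV(1,2) inner(2)[OF w]]) (rule that)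
    obtain b' where b': "b' \<in> V - {a, b, c}" "{b, b'} \<in> uncrossed_edges p V"
      by (rule corner_edge[OF V(1) triangle(1,2) ne(2) wV(1,3) inner(3)[OF w]]) (rule that)
    obtain c' where c': "c' \<in> V - {b, c, a}" "{c, c'} \<in> uncrossed_edges p V"
      by (rule corner_edge[OF V(1) triangle(2,3) ne(3) wV(1,4) inner(1)[OF w]]) (rule that)
    define f where "f v = orient (p b) (p c) (p v)" for v
    let ?C = "V - {a, b, c, a'}"
    define q where "q = arg_min_on (\<lambda>v. - f v) ?C"
    have "finite ?C" "?C \<noteq> {}" using V(1) more[of a'] by auto
    from arg_min_if_finite[OF this, of "\<lambda>v. - f v"]
    have q: "q \<in> ?C" "\<And>v. v \<in> ?C \<Longrightarrow> f v \<le> f q"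
      unfolding q_def by (auto simp: not_less)
    have "f q > 0" using inner(2)[of q] q(1) by (simp add: f_def)
    \<comment> \<open>The corners \<open>b\<close> and \<open>c\<close>, left out of the
      maximisation, lie on the reference line, where \<open>f\<close> is 0.\<close>
    then have far: "f v \<le> f q" if "v \<in> V - {a, a'}" for v
      using that q(2)[of v] by (cases "v \<in> {b, c}") (auto simp: f_def)
    have "p b \<noteq> p c" using \<open>f q > 0\<close> by (auto simp: f_def orient_def)
    note either = plane_drawing_insert_either[of p _ V b c a a' q, OF _ _ this]
    have either: "plane_drawing p (insert {a, q} E) \<or> plane_drawing p (insert {a', q} E)"
      if "plane_drawing p E" "E \<subseteq> edges_on V" for E
      using either[OF that] far a'_max[of q] a_max[of q] q(1) by (auto simp: f_def)
    let ?es = "[{a, b}, {b, c}, {c, a}, {a, a'}, {b, b'}, {c, c'}]"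
    define U where "U = set ?es"
    have U: "U \<subseteq> uncrossed_edges p V"
      using a' b' c' triangle(1-3) hull_arc_uncrossed by (auto simp: U_def)
    have in': "a' \<in> V" "a' \<notin> {a, b, c}" "b' \<notin> {a, b, c}" "c' \<notin> {a, b, c}"
      using a'(1) b'(1) c'(1) by auto
    then have "distinct ?es" using abc by (auto simp: doubleton_eq_iff)
    from distinct_card[OF this] have card: "card U = 6" by (simp only: U_def) simp
    have "{a, q} \<in> edges_on V - U" "{a', q} \<in> edges_on V - U" "{a, q} \<noteq> {a', q}"
      using abc in' q(1) by (auto simp: U_def pair_in_edges_on doubleton_eq_iff)
    \<comment> \<open>With h = 3 and u = 6 the bound 2u + 3h <= 21 is attained exactly, so the
      alternative pair is needed: it would require 105 + 21 + 18 <= 135 + 6 + 2.\<close>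
    from layers_uncrossed_bound_either[OF V(1) V3 gp L(1) L(2) U this either]
    show False using triangle(4) N V(2) card by simp
  qed
qed

subsection \<open>Layered drawings of complete graphs\<close>

lemma edge_seg_pair: "edge_seg p {a, b} = closed_segment (p a) (p b)"
  by (simp add: edge_seg_def segment_convex_hull)

lemma complete_edges_eq: "complete_edges n = edges_on (complete_vertices n)"
  by (auto simp: complete_edges_def edges_on_def complete_vertices_def)

text \<open>Every pair of vertices is an edge, so three collinear vertices would put one of them on
  an edge between the others. Conversely, in general position two edges can meet only at a shared
  endpoint or in a proper crossing.\<close>

lemma geom_layered_complete_iff:
  "geom_layered V (edges_on V) k \<longleftrightarrow>
     (\<exists>p layer. inj_on p V \<and> general_position p V \<and> (\<forall>e\<in>edges_on V. layer e < k) \<and>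
        (\<forall>i<k. plane_drawing p {e \<in> edges_on V. layer e = i}))"
  (is "_ \<longleftrightarrow> (\<exists>p layer. ?R p layer)")
proof
  assume "geom_layered V (edges_on V) k"
  then obtain p layer where inj: "inj_on p V"
    and avoid: "\<forall>e\<in>edges_on V. \<forall>w\<in>V. w \<notin> e \<longrightarrow> p w \<notin> edge_seg p e"
    and less: "\<forall>e\<in>edges_on V. layer e < k"
    and meet: "\<forall>e1\<in>edges_on V. \<forall>e2\<in>edges_on V. e1 \<noteq> e2 \<and> layer e1 = layer e2 \<longrightarrow>
      edge_seg p e1 \<inter> edge_seg p e2 \<subseteq> p ` (e1 \<inter> e2)"
    unfolding geom_layered_def by (elim exE conjE)
  have avoid': "p w \<notin> closed_segment (p u) (p v)" if "u \<in> V" "v \<in> V" "w \<in> V" "u \<noteq> v" "u \<noteq> w" "v \<noteq> w" for u v w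
    using bspec[OF bspec[OF avoid], of "{u, v}" w] that by (simp add: pair_in_edges_on edge_seg_pair)
  have "general_position p V"
    unfolding general_position_def using orient_0_imp_between avoid' by (metis (no_types))
  moreover have "plane_drawing p {e \<in> edges_on V. layer e = i}" for i
    unfolding plane_drawing_def
  proof (intro allI impI notI)
    fix a b c d
    assume e: "{a, b} \<in> {e \<in> edges_on V. layer e = i}" "{c, d} \<in> {e \<in> edges_on V. layer e = i}"
      and cr: "crosses (p a) (p b) (p c) (p d)"
    have "a \<noteq> c" "a \<noteq> d" "b \<noteq> c" "b \<noteq> d" using cr by (auto simp: crosses_def)
    then show False
      using bspec[OF bspec[OF meet], of "{a, b}" "{c, d}"] e crosses_imp_meet[OF cr]
      by (simp add: edge_seg_pair doubleton_eq_iff)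
  qed
  ultimately show "\<exists>p layer. ?R p layer" using inj less by blast
next
  assume "\<exists>p layer. ?R p layer"
  then obtain p layer where inj: "inj_on p V" and gp: "general_position p V"
    and less: "\<forall>e\<in>edges_on V. layer e < k"
    and plane: "\<And>i. i < k \<Longrightarrow> plane_drawing p {e \<in> edges_on V. layer e = i}" by blast
  have "p w \<notin> edge_seg p e" if ew: "e \<in> edges_on V" "w \<in> V" "w \<notin> e" for e w
  proof
    assume w: "p w \<in> edge_seg p e"
    obtain u v where e: "e = {u, v}" "u \<in> V" "v \<in> V" "u \<noteq> v" using ew(1) by (auto simp: edges_on_def)
    then obtain t where "p w = (1 - t) *\<^sub>R p u + t *\<^sub>R p v" using w by (auto simp: edge_seg_pair in_segment)
    then have "orient (p u) (p v) (p w) = 0" using orient_affine[of "p u" "p v" t "p u" "p v"] by simp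
    then show False using general_positionD[OF gp, of u v w] e ew by auto
  qed
  moreover have "edge_seg p e1 \<inter> edge_seg p e2 \<subseteq> p ` (e1 \<inter> e2)"
    if e: "e1 \<in> edges_on V" "e2 \<in> edges_on V" "e1 \<noteq> e2" "layer e1 = layer e2" for e1 e2
  proof (cases "e1 \<inter> e2 = {}")
    case True
    obtain a b c d where abcd: "e1 = {a, b}" "e2 = {c, d}" "a \<in> V" "b \<in> V" "c \<in> V" "d \<in> V" "a \<noteq> b" "c \<noteq> d"
      using e(1,2) unfolding edges_on_def by blast
    then have ne: "a \<noteq> c" "a \<noteq> d" "b \<noteq> c" "b \<noteq> d" using True by auto
    have "\<not> crosses (p a) (p b) (p c) (p d)"
      using plane[of "layer e1"] e less abcd by (simp add: plane_drawing_def)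
    then show ?thesis
      using meet_imp_crosses general_positionD[OF gp] abcd ne by (metis edge_seg_pair subsetI emptyE)
  next
    case False
    then obtain a where a: "a \<in> e1" "a \<in> e2" by auto
    obtain b where b: "e1 = {a, b}" "a \<in> V" "b \<in> V" "a \<noteq> b" using e(1) a by (auto simp: edges_on_def)
    obtain c where c: "e2 = {a, c}" "c \<in> V" "a \<noteq> c" using e(2) a by (auto simp: edges_on_def)
    have "b \<noteq> c" using e(3) b c by auto
    then have "orient (p a) (p b) (p c) \<noteq> 0" using general_positionD[OF gp] b c by blast
    then have "edge_seg p e1 \<inter> edge_seg p e2 \<subseteq> {p a}" using meet_at_endpoint b c by (simp add: edge_seg_pair)
    then show ?thesis using a by auto
  qed
  ultimately show "geom_layered V (edges_on V) k"
    unfolding geom_layered_def using inj less by blast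
qed

lemma no_three_layers:
  assumes "k \<le> 3"
  shows "\<not> geom_layered (complete_vertices 15) (complete_edges 15) k"
proof
  let ?V = "complete_vertices 15"
  assume "geom_layered ?V (complete_edges 15) k"
  then obtain p layer where gp: "general_position p ?V"
    and less: "\<forall>e\<in>edges_on ?V. layer e < k"
    and plane: "\<forall>i<k. plane_drawing p {e \<in> edges_on ?V. layer e = i}"
    unfolding complete_edges_eq geom_layered_complete_iff by (elim exE conjE)
  \<comment> \<open>Three layers are formed in any case; those with index at least \<open>k\<close>
    are empty.\<close>
  define L where "L i = {e \<in> edges_on ?V. layer e = i}" for i
  have "layer e < 3" if "e \<in> edges_on ?V" for e using bspec[OF less that] assms by simp
  then have "(\<Union>i<3. L i) = edges_on ?V" by (auto simp: L_def)
  moreover have "plane_drawing p (L i)" for i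
  proof (cases "i < k")
    case False
    then have "L i = {}" using less by (auto simp: L_def)
    then show ?thesis by (simp add: plane_drawing_def)
  qed (simp add: L_def plane)
  moreover have "finite ?V" "card ?V = 15" by (simp_all add: complete_vertices_def)
  ultimately show False using no_three_plane_layers[of ?V p L] gp by simp
qed

text \<open>Two concentric octagons (one vertex missing), the outer one distorted so that its long
  diagonals avoid the inner one. In each layer, the inner octagon carries a zigzag path, the two
  outer vertices in the direction perpendicular to the path are joined to all inner vertices, and the
  outer octagon carries two zigzags around the inner one.\<close>

definition octagons :: "(int \<times> int) list" where
  "octagons =
     [(6, 1), (3, 5), (-1, 6), (-5, 3), (-6, -1), (-3, -5), (1, -6), (5, -3),
      (90, 7), (59, 69), (-7, 90), (-69, 59), (-90, 7), (-69, -59), (-7, -90)]"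

text \<open>Intended for a < b, with inner vertices 0 to 7 and outer vertices from 8 on. Chords of a
  regular octagon with equal a + b modulo 8 are parallel, and two consecutive classes form a zigzag;
  dividing by 2 merges them. Opposite outer vertices b and b + 4 agree modulo 4 and share a
  layer.\<close>

definition octagon_layer :: "nat \<Rightarrow> nat \<Rightarrow> nat" where
  "octagon_layer a b =
     (if b < 8 then (a + b + 1) mod 8 div 2
      else if a < 8 then (b + 2) mod 4
      else (a + b) mod 8 div 2)"

definition octagon_edges :: "nat \<Rightarrow> (nat \<times> nat) list" where
  "octagon_edges i = filter (\<lambda>(a, b). octagon_layer a b = i)
     (concat (map (\<lambda>b. map (\<lambda>a. (a, b)) [0..<b]) [0..<15]))"

section \<open>Verification of the octagon drawing\<close>

lemma octagons_general_position:
  "list_all (\<lambda>c. list_all (\<lambda>b. list_all (\<lambda>a. orient (octagons ! a) (octagons ! b) (octagons ! c) \<noteq> 0)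
     [0..<b]) [0..<c]) [0..<15]"
  by code_simp

lemma octagons_plane:
  "list_all (\<lambda>i. list_all (\<lambda>(a, b). list_all (\<lambda>(c, d).
     \<not> crosses (octagons ! a) (octagons ! b) (octagons ! c) (octagons ! d))
     (octagon_edges i)) (octagon_edges i)) [0..<4]"
  by code_simp

text \<open>Permuting the three points changes the orientation only by a sign, so the finite check
  can be limited to increasing triples.\<close>

lemma general_position_linorderI:
  fixes V :: "'v::linorder set"
  assumes "\<And>a b c. a \<in> V \<Longrightarrow> b \<in> V \<Longrightarrow> c \<in> V \<Longrightarrow> a < b \<Longrightarrow> b < c \<Longrightarrow> orient (p a) (p b) (p c) \<noteq> 0"
  shows "general_position p V"
  unfolding general_position_def
proof (intro ballI impI)
  fix a b c assume V: "a \<in> V" "b \<in> V" "c \<in> V" and ne: "a \<noteq> b" "a \<noteq> c" "b \<noteq> c"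
  have perm: "orient (p b) (p c) (p a) = orient (p a) (p b) (p c)"
    "orient (p c) (p a) (p b) = orient (p a) (p b) (p c)"
    "orient (p b) (p a) (p c) = - orient (p a) (p b) (p c)"
    "orient (p a) (p c) (p b) = - orient (p a) (p b) (p c)"
    "orient (p c) (p b) (p a) = - orient (p a) (p b) (p c)"
    by (simp_all add: orient_def algebra_simps)
  consider "a < b" "b < c" | "b < c" "c < a" | "c < a" "a < b"
    | "b < a" "a < c" | "a < c" "c < b" | "c < b" "b < a"
    using ne by (meson linorder_neqE)
  then show "orient (p a) (p b) (p c) \<noteq> 0"
    using assms V perm by cases (metis neg_equal_0_iff_equal)+
qed

lemma set_octagon_edges:
  "(a, b) \<in> set (octagon_edges i) \<longleftrightarrow> a < b \<and> b < 15 \<and> octagon_layer a b = i"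
  by (auto simp: octagon_edges_def image_iff)

lemma four_layers: "geom_layered (complete_vertices 15) (complete_edges 15) 4"
proof -
  let ?V = "complete_vertices 15"
  define p where "p v = (real_of_int (fst (octagons ! v)), real_of_int (snd (octagons ! v)))" for v
  \<comment> \<open>Minimum and maximum recover the increasing pair expected by
    \<open>octagon_layer\<close>.\<close>
  define layer where "layer e = octagon_layer (Min e) (Max e)" for e
  \<comment> \<open>Orientation is an integer polynomial in the coordinates, so the embedding of the
    integers into the reals carries the evaluated checks over.\<close>
  have orient: "orient (p a) (p b) (p c) = of_int (orient (octagons ! a) (octagons ! b) (octagons ! c))" for a b c
    by (simp add: p_def orient_def)
  have crosses: "crosses (p a) (p b) (p c) (p d) \<longleftrightarrow>
      crosses (octagons ! a) (octagons ! b) (octagons ! c) (octagons ! d)" for a b c d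
    unfolding crosses_def orient by (simp flip: of_int_mult)
  have gp: "general_position p ?V"
    using octagons_general_position
    by (intro general_position_linorderI) (auto simp: orient list_all_iff complete_vertices_def)
  have "layer e < 4" for e
    by (simp add: layer_def octagon_layer_def less_mult_imp_div_less)
  moreover have "plane_drawing p {e \<in> edges_on ?V. layer e = i}" if i: "i < 4" for i
    unfolding plane_drawing_def
  proof (intro allI impI)
    fix a b c d
    assume e: "{a, b} \<in> {e \<in> edges_on ?V. layer e = i}" "{c, d} \<in> {e \<in> edges_on ?V. layer e = i}"
    have sorted: "(min u v, max u v) \<in> set (octagon_edges i)" if "{u, v} \<in> {e \<in> edges_on ?V. layer e = i}" for u v
      using that by (auto simp: set_octagon_edges layer_def pair_in_edges_on complete_vertices_def min_def max_def)
    have "\<not> crosses (p (min a b)) (p (max a b)) (p (min c d)) (p (max c d))"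
      using octagons_plane i sorted[OF e(1)] sorted[OF e(2)] unfolding crosses list_all_iff by fastforce
    then show "\<not> crosses (p a) (p b) (p c) (p d)"
      by (auto simp: min_def max_def crosses_flip crosses_flip_right split: if_splits)
  qed
  moreover have "inj_on p ?V" using general_position_inj_on[OF gp] by (simp add: complete_vertices_def)
  ultimately show ?thesis unfolding complete_edges_eq geom_layered_complete_iff using gp by blast
qed

theorem theorem4p1:
  shows "geometric_thickness (complete_vertices 15) (complete_edges 15) = 4"
  unfolding geometric_thickness_def
proof (rule Least_equality)
  show "4 \<le> k" if "geom_layered (complete_vertices 15) (complete_edges 15) k" for k
    using no_three_layers[of k] that by (cases "k \<le> 3") auto
qed (rule four_layers)

end
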